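(* Let $A\in\mathbb{R}^{m\times n}$ be a mean-centred matrix (its rows sum to zero) and let $1\le p\le n$. Let $\mathbb{R}^{n\times p}_p$ denote the set of full-rank $n\times p$ real matrices, and define $$f_{\det}:\mathbb{R}^{n\times p}_p\to\mathbb{R},\qquad f_{\det}(X)=\frac{\det(X^*A^*AX)}{\det(X^*X)}.$$ Consider the program $\arg\max\{f_{\det}(X): X\in\mathbb{R}^{n\times p}_p\}$. The following statements hold true: (i) $\widetilde X\in\mathbb{R}^{n\times p}$ is a global maximiser of the program if and only if there exists a $p$-leading right singular factor $V_p\in\mathbb{R}^{n\times p}$ of $A$ such that $\operatorname{range}(\widetilde X)=\operatorname{range}(V_p)$. (ii) The program does not have any spurious local optima, namely, any local maximum or minimum of $f_{\det}$ on $\mathbb{R}^{n\times p}_p$ is also a global maximum or minimum, respectively, and all other stationary points are strict saddle points. Moreover, if $\sigma_p(A)>\sigma_{p+1}(A)$, then at any such strict saddle point $X_s$ there exists an ascent direction $\Delta\in\mathbb{R}^{n\times p}$ such that $$\nabla^2 f_{\det}(X_s)[\Delta,\Delta]\ \ge\ f_{\det}(X_s)\left(\frac{\sigma_p^2(A)}{\sigma_{p+1}^2(A)}-1\right)\|\Delta\|_F^2 .$$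
   Context: $X^*$ denotes the transpose of $X$; $\operatorname{range}(X)$ is the column span of $X$; $\|\cdot\|_F$ is the Frobenius norm. $\sigma_1(A)\ge\sigma_2(A)\ge\cdots$ are the singular values of $A$ in nonincreasing order, counted with multiplicity and padded with zeros, so that $\sigma_i^2(A)$, $i=1,\dots,n$, are the eigenvalues of $A^*A$. A $p$-leading right singular factor of $A$ is an $n\times p$ matrix with orthonormal columns consisting of $p$ leading right singular vectors of $A$, i.e. right singular vectors of $A$ (eigenvectors of $A^*A$) corresponding to its $p$ largest singular values. A stationary point is a point $X_s\in\mathbb{R}^{n\times p}_p$ with $\nabla f_{\det}(X_s)=0$. An ascent direction at a stationary point $X_s$ is a $\Delta$ with $\nabla^2 f_{\det}(X_s)[\Delta,\Delta]>0$. A saddle point is strict if it has an ascent direction. The bilinear operator $\nabla^2 f_{\det}(X_s):\mathbb{R}^{n\times p}\times\mathbb{R}^{n\times p}\to\mathbb{R}$ is the Hessian of $f_{\det}$ at $X_s$, normalised so that $\nabla^2 f_{\det}(X_s)[\Delta,\Delta]$ is the second-order term in the expansion $f_{\det}(X_s+\Delta)=f_{\det}(X_s)+\nabla^2 f_{\det}(X_s)[\Delta,\Delta]+o(\|\Delta\|^2)$ at a stationary point (no factor $1/2$).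
   Formalization: In (i), "only if" is proved when σ_p(A)>0 (it fails when f_det vanishes identically); "if" holds always. In (ii), the Hessian bound is divided by the squared spectral norm of X_s, and holds as written when X_s has orthonormal columns (it fails for scaled X_s). *)

theory Defs
  imports "HOL-Analysis.Analysis" "HOL-Library.Multiset"
begin

text \<open>
  An $n \times p$ matrix is an element of \<^typ>\<open>real^'p^'n\<close>; its \<^const>\<open>norm\<close> (the Euclidean norm of
  the vector of Euclidean norms of its rows) is the Frobenius norm.
\<close>

definition mean_centred :: "real^'n^'m \<Rightarrow> bool"
  where "mean_centred A \<longleftrightarrow> (\<Sum>i\<in>UNIV. row i A) = 0"

text \<open>Only used for $p \le n$, when full rank means rank $p$.\<close>

definition full_rank :: "(real^'p^'n) set"
  where "full_rank = {X. rank X = CARD('p)}"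

definition f_det :: "real^'n^'m \<Rightarrow> real^'p^'n \<Rightarrow> real"
  where "f_det A X = det (transpose X ** transpose A ** A ** X) / det (transpose X ** X)"

definition orthonormal_columns :: "real^'p^'n \<Rightarrow> bool"
  where "orthonormal_columns V \<longleftrightarrow> transpose V ** V = mat 1"

definition eigenspace :: "real^'n^'n \<Rightarrow> real \<Rightarrow> (real^'n) set"
  where "eigenspace M \<mu> = {v. M *v v = \<mu> *\<^sub>R v}"

text \<open>
  The square roots of the $n$ eigenvalues of $A^* A$ with multiplicity. As $A^* A$ is symmetric,
  geometric and algebraic multiplicities coincide.
\<close>

definition singular_values :: "real^'n^'m \<Rightarrow> real multiset"
  where "singular_values A =
    (\<Sum>\<mu> | eigenspace (transpose A ** A) \<mu> \<noteq> {0}.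
       replicate_mset (dim (eigenspace (transpose A ** A) \<mu>)) (sqrt \<mu>))"

text \<open>The $i$-th largest singular value; indices start at 1, with zero padding beyond $n$.\<close>

definition sing_val :: "real^'n^'m \<Rightarrow> nat \<Rightarrow> real"
  where "sing_val A i =
    (let s = rev (sorted_list_of_multiset (singular_values A))
     in if 1 \<le> i \<and> i \<le> length s then s ! (i - 1) else 0)"

text \<open>
  The bijection assigns the $p$ columns to the $p$ largest singular values counted with
  multiplicity; the columns may come in any order.
\<close>

definition leading_right_singular_factor :: "real^'n^'m \<Rightarrow> real^'p^'n \<Rightarrow> bool"
  where "leading_right_singular_factor A V \<longleftrightarrow> orthonormal_columns V \<and>
    (\<exists>\<pi>. bij_betw \<pi> (UNIV :: 'p set) {1..CARD('p)} \<and>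
      (\<forall>j. column j V \<in> eigenspace (transpose A ** A) ((sing_val A (\<pi> j))\<^sup>2)))"

definition local_max_on :: "'a::topological_space set \<Rightarrow> ('a \<Rightarrow> real) \<Rightarrow> 'a \<Rightarrow> bool"
  where "local_max_on S f x \<longleftrightarrow> x \<in> S \<and> (\<forall>\<^sub>F y in at x within S. f y \<le> f x)"

definition local_min_on :: "'a::topological_space set \<Rightarrow> ('a \<Rightarrow> real) \<Rightarrow> 'a \<Rightarrow> bool"
  where "local_min_on S f x \<longleftrightarrow> x \<in> S \<and> (\<forall>\<^sub>F y in at x within S. f x \<le> f y)"

definition global_max_on :: "'a set \<Rightarrow> ('a \<Rightarrow> real) \<Rightarrow> 'a \<Rightarrow> bool"
  where "global_max_on S f x \<longleftrightarrow> is_arg_max f (\<lambda>y. y \<in> S) x"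

definition global_min_on :: "'a set \<Rightarrow> ('a \<Rightarrow> real) \<Rightarrow> 'a \<Rightarrow> bool"
  where "global_min_on S f x \<longleftrightarrow> is_arg_min f (\<lambda>y. y \<in> S) x"

definition stationary_on :: "'a::real_inner set \<Rightarrow> ('a \<Rightarrow> real) \<Rightarrow> 'a \<Rightarrow> bool"
  where "stationary_on S f x \<longleftrightarrow> x \<in> S \<and> GDERIV f x :> 0"

text \<open>
  Half the second Frechet derivative, so that
  $f(x + d) = f(x) + \nabla^2 f(x)[d,d] + o(\|d\|^2)$ at a stationary point.
\<close>

definition hessian :: "('a::real_normed_vector \<Rightarrow> real) \<Rightarrow> 'a \<Rightarrow> 'a \<Rightarrow> 'a \<Rightarrow> real"
  where "hessian f x d e =
    frechet_derivative (\<lambda>y. frechet_derivative f (at y) e) (at x) d / 2"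

definition ascent_direction :: "('a::real_normed_vector \<Rightarrow> real) \<Rightarrow> 'a \<Rightarrow> 'a \<Rightarrow> bool"
  where "ascent_direction f x d \<longleftrightarrow> hessian f x d d > 0"

definition saddle_on :: "'a::real_inner set \<Rightarrow> ('a \<Rightarrow> real) \<Rightarrow> 'a \<Rightarrow> bool"
  where "saddle_on S f x \<longleftrightarrow>
    stationary_on S f x \<and> \<not> local_max_on S f x \<and> \<not> local_min_on S f x"

definition strict_saddle_on :: "'a::real_inner set \<Rightarrow> ('a \<Rightarrow> real) \<Rightarrow> 'a \<Rightarrow> bool"
  where "strict_saddle_on S f x \<longleftrightarrow> saddle_on S f x \<and> (\<exists>d. ascent_direction f x d)"

end

theory Submission
  imports Defs
begin

text \<open>
  The value \<open>f X\<close> depends only on the range of \<open>X\<close>. Writing \<open>M = A\<^sup>T A\<close>, a stationary point with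
  \<open>f X > 0\<close> has an \<open>M\<close>-invariant range, so the range and its orthogonal complement have orthonormal
  eigenbases. Exchanging an eigenvector \<open>u\<close> of the range (eigenvalue \<open>\<alpha>\<close>) for an eigenvector \<open>v\<close> of
  the complement (eigenvalue \<open>\<beta>\<close>) by \<open>X + t v (X\<^sup>T u)\<^sup>T\<close> multiplies \<open>f\<close> by
  \<open>(1 + t\<^sup>2 \<beta> / \<alpha>) / (1 + t\<^sup>2)\<close>. This is an ascent direction with Hessian \<open>f X (\<beta> / \<alpha> - 1)\<close>
  when \<open>\<alpha> < \<beta>\<close>, so a local maximum has a leading invariant range, and a local minimum a trailing one.
  Hence \<open>f\<close> takes one value at all local maxima, and compactness supplies a global one to compare with.
  A local maximum with value zero is impossible unless \<open>f\<close> vanishes identically, because the numerator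
  is a polynomial.
\<close>

section \<open>Rank-one perturbations and second derivatives\<close>

text \<open>The forward half of (i) needs sigma_p > 0: if sigma_p = 0, the optimal value is 0, so f
  vanishes identically and every full-rank matrix is a maximiser, whatever its range. The gap
  estimate must take the scale of X into account: f (c X) = f X, but the Hessian at c X in a fixed
  direction is c^-2 times the one at X, so no bound by the squared norm of the direction alone
  survives large c. The exchange direction has the norm of X^T u, at most the operator norm of X;
  hence the divisor, which is replaced by 1 for orthonormal columns. For this estimate an arbitrary
  improving exchange is too weak: the pair has to straddle the gap, which a counting argument on an
  eigenbasis provides. At a saddle f is positive, so the eigenvalue exchanged away is positive;
  being at most sigma_(p+1)^2, it makes sigma_p^2 / sigma_(p+1)^2 a genuine quotient. The upper
  bound on f by the product of the leading sigma_i^2 comes from no determinant inequality: a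
  maximiser exists, it is a local maximum, and local maxima have that value.\<close>

definition outer :: "real^'n \<Rightarrow> real^'m \<Rightarrow> real^'m^'n"
  where "outer a b = (\<chi> i j. a $ i * b $ j)"

lemma matrix_mul_outer: "A ** outer a b = outer (A *v a) b"
  by (simp add: outer_def matrix_matrix_mult_def matrix_vector_mult_def vec_eq_iff
      sum_distrib_left mult_ac)

lemma outer_matrix_mul: "outer a b ** A = outer a (transpose A *v b)"
  by (simp add: outer_def matrix_matrix_mult_def matrix_vector_mult_def vec_eq_iff transpose_def
      sum_distrib_left mult_ac)

lemma outer_mult_vector: "outer a b *v x = (b \<bullet> x) *\<^sub>R a"
  by (simp add: outer_def matrix_vector_mult_def vec_eq_iff inner_vec_def
      sum_distrib_left mult_ac)

lemma outer_scaleR: "outer (c *\<^sub>R a) b = c *\<^sub>R outer a b" "outer a (c *\<^sub>R b) = c *\<^sub>R outer a b"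
  by (simp_all add: outer_def vec_eq_iff)

lemma outer_zero: "outer 0 b = 0" "outer a 0 = 0"
  by (simp_all add: outer_def vec_eq_iff)

lemma norm_outer: "norm (outer a b) = norm a * norm b"
proof -
  have "outer a b $ i = a $ i *\<^sub>R b" for i
    by (simp add: outer_def vec_eq_iff)
  then have "norm (outer a b) = L2_set (\<lambda>i. norm (a $ i) * norm b) UNIV"
    unfolding norm_vec_def[of "outer a b"] by simp
  then show ?thesis
    unfolding norm_vec_def[of a] by (simp add: L2_set_left_distrib)
qed

text \<open>Cramer's rule for the identity matrix: b is the combination of the unit rows whose
  coefficients are its own entries.\<close>

lemma det_mat_1_replace_row:
  "det ((\<chi> i. if i = k then b else axis i 1) :: real^'n^'n) = b $ k"
proof -
  have "(\<Sum>i\<in>UNIV. b $ i *s row i (mat 1 :: real^'n^'n)) = b"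
    by (simp add: vec_eq_iff row_def mat_def if_distrib cong: if_cong)
  moreover have "row i (mat 1 :: real^'n^'n) = axis i 1" for i
    by (auto simp: vec_eq_iff row_def mat_def axis_def)
  ultimately show ?thesis
    using cramer_lemma_transpose[of k b "mat 1"] by (simp cong: if_cong)
qed

text \<open>The matrix determinant lemma, by switching on the perturbation one row at a time and
  using linearity in that row.\<close>

lemma det_mat_1_add_outer: "det (mat 1 + outer a b :: real^'n^'n) = 1 + b \<bullet> a"
proof -
  define C where "C S i = (if i \<in> S then axis i 1 + a $ i *s b else axis i 1)" for S and i :: 'n
  \<comment> \<open>Once row k is b, the multiples of b added to other rows are multiples of row k
    and do not affect the determinant.\<close>
  have row_b: "det (\<chi> i. if i = k then b else C S i) = b $ k" if "k \<notin> S" "finite S" for k S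
    using that(2,1)
  proof (induction S)
    case empty
    show ?case
      using det_mat_1_replace_row[of k b] by (simp add: C_def cong: if_cong)
  next
    case (insert j S)
    define D where "D i = (if i = k then b else C S i)" for i
    have "(\<chi> i. if i = k then b else C (insert j S) i)
        = (\<chi> i. if i = j then axis j 1 + a $ j *s b else D i)"
      using insert by (auto simp: vec_eq_iff C_def D_def)
    then have "det (\<chi> i. if i = k then b else C (insert j S) i)
        = det (\<chi> i. if i = j then axis j 1 else D i) + a $ j * det (\<chi> i. if i = j then b else D i)"
      by (simp add: det_row_add det_row_mul)
    also have "(\<chi> i. if i = j then axis j 1 else D i) = (\<chi> i. if i = k then b else C S i)"
      using insert by (auto simp: vec_eq_iff C_def D_def)
    also have "det (\<chi> i. if i = j then b else D i) = 0"
      using insert by (intro det_identical_rows[of j k]) (auto simp: row_def D_def vec_eq_iff)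
    finally show ?case
      using insert by simp
  qed
  have "det (\<chi> i. C S i) = 1 + (\<Sum>i\<in>S. a $ i * b $ i)" if "finite S" for S
    using that
  proof (induction S)
    case empty
    have "(\<chi> i. C {} i) = mat 1"
      by (auto simp: C_def vec_eq_iff axis_def mat_def)
    then show ?case
      by simp
  next
    case (insert k S)
    have "(\<chi> i. C (insert k S) i) = (\<chi> i. if i = k then axis k 1 + a $ k *s b else C S i)"
      using insert by (auto simp: vec_eq_iff C_def)
    then have "det (\<chi> i. C (insert k S) i)
        = det (\<chi> i. if i = k then axis k 1 else C S i) + a $ k * det (\<chi> i. if i = k then b else C S i)"
      by (simp add: det_row_add det_row_mul)
    also have "(\<chi> i. if i = k then axis k 1 else C S i) = (\<chi> i. C S i)"
      using insert by (auto simp: vec_eq_iff C_def)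
    finally show ?case
      using insert row_b by simp
  qed
  moreover have "mat 1 + outer a b = (\<chi> i. C UNIV i)"
    by (auto simp: C_def vec_eq_iff axis_def mat_def outer_def)
  ultimately show ?thesis
    by (simp add: inner_vec_def mult.commute)
qed

text \<open>A preimage w of a stands in for the inverse of B applied to a, so that singular B is
  covered. The reason is B + a b^T = B (I + w b^T).\<close>

lemma det_add_outer:
  fixes B :: "real^'n^'n"
  assumes "B *v w = a"
  shows "det (B + outer a b) = det B * (1 + b \<bullet> w)"
proof -
  have "B + outer a b = B ** (mat 1 + outer w b)"
    by (simp add: matrix_add_ldistrib matrix_mul_outer assms)
  then show ?thesis
    by (simp add: det_mul det_mat_1_add_outer)
qed

text \<open>Tailored to \<open>hessian\<close>, which differentiates a directional derivative in the
  base point: a derivative f' is required on S, together with differentiability of its value in each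
  fixed direction.\<close>

definition twice_differentiable_on :: "('a::real_normed_vector \<Rightarrow> real) \<Rightarrow> 'a set \<Rightarrow> bool"
  where "twice_differentiable_on f S \<longleftrightarrow>
    (\<exists>f'. \<forall>x\<in>S. (f has_derivative f' x) (at x) \<and> (\<forall>e. (\<lambda>y. f' y e) differentiable (at x)))"

lemma twice_differentiable_on_const: "twice_differentiable_on (\<lambda>x. c) S"
  unfolding twice_differentiable_on_def by (rule exI[of _ "\<lambda>_ _. 0"]) auto

lemma twice_differentiable_on_bounded_linear:
  "bounded_linear f \<Longrightarrow> twice_differentiable_on f S"
  unfolding twice_differentiable_on_def
  by (rule exI[of _ "\<lambda>_. f"]) (auto intro: bounded_linear_imp_has_derivative)

lemma twice_differentiable_on_add:
  assumes "twice_differentiable_on f S" "twice_differentiable_on g S"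
  shows "twice_differentiable_on (\<lambda>x. f x + g x) S"
proof -
  obtain f' g' where
      "\<forall>x\<in>S. (f has_derivative f' x) (at x) \<and> (\<forall>e. (\<lambda>y. f' y e) differentiable (at x))"
      "\<forall>x\<in>S. (g has_derivative g' x) (at x) \<and> (\<forall>e. (\<lambda>y. g' y e) differentiable (at x))"
    using assms unfolding twice_differentiable_on_def by blast
  then show ?thesis
    unfolding twice_differentiable_on_def
    by (intro exI[of _ "\<lambda>x e. f' x e + g' x e"])
      (auto intro: has_derivative_add differentiable_add)
qed

lemma twice_differentiable_on_mult:
  assumes "twice_differentiable_on f S" "twice_differentiable_on g S"
  shows "twice_differentiable_on (\<lambda>x. f x * g x) S"
proof -
  obtain f' g' where
      *: "\<forall>x\<in>S. (f has_derivative f' x) (at x) \<and> (\<forall>e. (\<lambda>y. f' y e) differentiable (at x))"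
      "\<forall>x\<in>S. (g has_derivative g' x) (at x) \<and> (\<forall>e. (\<lambda>y. g' y e) differentiable (at x))"
    using assms unfolding twice_differentiable_on_def by blast
  then have "\<forall>x\<in>S. f differentiable (at x) \<and> g differentiable (at x)"
    using differentiable_def by blast
  with * show ?thesis
    unfolding twice_differentiable_on_def
    by (intro exI[of _ "\<lambda>x e. f x * g' x e + f' x e * g x"])
      (auto intro: has_derivative_mult differentiable_add differentiable_mult)
qed

lemma twice_differentiable_on_inverse:
  assumes "twice_differentiable_on f S" "\<And>x. x \<in> S \<Longrightarrow> f x \<noteq> 0"
  shows "twice_differentiable_on (\<lambda>x. inverse (f x)) S"
proof -
  obtain f' where
      *: "\<forall>x\<in>S. (f has_derivative f' x) (at x) \<and> (\<forall>e. (\<lambda>y. f' y e) differentiable (at x))"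
    using assms unfolding twice_differentiable_on_def by blast
  then have "\<forall>x\<in>S. f differentiable (at x)"
    using differentiable_def by blast
  then have "\<forall>x\<in>S. (\<lambda>y. inverse (f y)) differentiable (at x)"
    using assms(2) by (auto intro: differentiable_inverse)
  with * assms(2) show ?thesis
    unfolding twice_differentiable_on_def
    by (intro exI[of _ "\<lambda>x e. - (inverse (f x) * f' x e * inverse (f x))"])
      (auto intro!: has_derivative_inverse differentiable_minus differentiable_mult)
qed

lemma twice_differentiable_on_sum:
  "(\<And>i. i \<in> I \<Longrightarrow> twice_differentiable_on (f i) S) \<Longrightarrow> twice_differentiable_on (\<lambda>x. \<Sum>i\<in>I. f i x) S"
  by (induction I rule: infinite_finite_induct)
    (auto intro: twice_differentiable_on_const twice_differentiable_on_add)

lemma twice_differentiable_on_prod: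
  "(\<And>i. i \<in> I \<Longrightarrow> twice_differentiable_on (f i) S) \<Longrightarrow> twice_differentiable_on (\<lambda>x. \<Prod>i\<in>I. f i x) S"
  by (induction I rule: infinite_finite_induct)
    (auto intro: twice_differentiable_on_const twice_differentiable_on_mult)

lemma twice_differentiable_on_det:
  fixes F :: "'a::real_normed_vector \<Rightarrow> real^'n^'n"
  assumes "\<And>i j. twice_differentiable_on (\<lambda>x. F x $ i $ j) S"
  shows "twice_differentiable_on (\<lambda>x. det (F x)) S"
  unfolding det_def
  by (intro twice_differentiable_on_sum twice_differentiable_on_mult
      twice_differentiable_on_const twice_differentiable_on_prod assms)

lemma twice_differentiable_on_entry: "twice_differentiable_on (\<lambda>X. X $ i $ j) S"
  by (intro twice_differentiable_on_bounded_linear bounded_linear_compose[OF bounded_linear_vec_nth]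
      bounded_linear_vec_nth)

text \<open>\<open>hessian\<close> is built from \<open>frechet_derivative\<close>, a choice, so it
  carries no information until differentiability is known. Given that, the chain rule makes it half
  the second derivative along the line, the half coming from the normalisation.\<close>

lemma hessian_along_line:
  assumes S: "open S" "x \<in> S" and f: "twice_differentiable_on f S"
    and line: "\<And>t. f (x + t *\<^sub>R d) = g t"
    and g': "\<And>t. (g has_real_derivative g' t) (at t)"
    and g'': "(g' has_real_derivative c) (at 0)"
  shows "hessian f x d d = c / 2"
proof -
  obtain f' where f':
      "\<forall>x\<in>S. (f has_derivative f' x) (at x) \<and> (\<forall>e. (\<lambda>y. f' y e) differentiable (at x))"
    using f unfolding twice_differentiable_on_def by blast
  have fd: "frechet_derivative f (at y) = f' y" if "y \<in> S" for y
    using f' that frechet_derivative_at by metis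
  let ?l = "\<lambda>t. x + t *\<^sub>R d"
  have l: "(?l has_derivative (\<lambda>s. s *\<^sub>R d)) (at t)" for t
    by (auto intro!: derivative_eq_intros)
  obtain h where h: "((\<lambda>y. f' y d) has_derivative h) (at x)"
    using f' S unfolding differentiable_def by blast
  \<comment> \<open>\<open>frechet_derivative f\<close> and f' are known to agree only on S, which
    suffices because S is open.\<close>
  then have "((\<lambda>y. frechet_derivative f (at y) d) has_derivative h) (at x)"
    by (rule has_derivative_transform_within_open[OF _ S]) (simp add: fd)
  then have hess: "hessian f x d d = h d / 2"
    unfolding hessian_def using frechet_derivative_at by metis
  have "open (?l -` S)"
    by (intro open_vimage S continuous_intros)
  moreover have "0 \<in> ?l -` S"
    using S by simp
  moreover have "f' (?l t) d = g' t" if "t \<in> ?l -` S" for t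
  proof -
    have "((f \<circ> ?l) has_derivative (f' (?l t) \<circ> (\<lambda>s. s *\<^sub>R d))) (at t)"
      using l f' that by (intro diff_chain_at) auto
    then have "(g has_derivative (\<lambda>s. f' (?l t) (s *\<^sub>R d))) (at t)"
      by (simp add: o_def line)
    then have "(\<lambda>s. f' (?l t) (s *\<^sub>R d)) = (*) (g' t)"
      using g' has_derivative_unique unfolding has_field_derivative_def by blast
    then show ?thesis
      by (metis mult.right_neutral scaleR_one)
  qed
  moreover have "((\<lambda>t. f' (?l t) d) has_derivative (\<lambda>s. h (s *\<^sub>R d))) (at 0)"
    using diff_chain_at[of ?l _ 0, OF l, of "\<lambda>y. f' y d" h] h by (simp add: o_def)
  ultimately have "(g' has_derivative (\<lambda>s. h (s *\<^sub>R d))) (at 0)"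
    by (metis (mono_tags, lifting) has_derivative_transform_within_open)
  then have "(\<lambda>s. h (s *\<^sub>R d)) = (*) c"
    using g'' has_derivative_unique unfolding has_field_derivative_def by blast
  then have "h d = c"
    by (metis mult.right_neutral scaleR_one)
  with hess show ?thesis
    by simp
qed

section \<open>Symmetric matrices and singular values\<close>

text \<open>The Rayleigh form. On a unit eigenvector it returns the eigenvalue, so eigenvalues
  become a function of the basis vector and none has to be chosen.\<close>

definition eigval :: "real^'n^'n \<Rightarrow> real^'n \<Rightarrow> real"
  where "eigval M s = s \<bullet> (M *v s)"

definition orthonormal_eigenbasis :: "real^'n^'n \<Rightarrow> (real^'n) set \<Rightarrow> (real^'n) set \<Rightarrow> bool"
  where "orthonormal_eigenbasis M W S \<longleftrightarrow> pairwise orthogonal S \<and>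
    (\<forall>s\<in>S. norm s = 1 \<and> M *v s = eigval M s *\<^sub>R s) \<and> span S = W"

lemma symmetric_inner:
  fixes M :: "real^'n^'n"
  assumes "transpose M = M"
  shows "x \<bullet> (M *v y) = (M *v x) \<bullet> y"
  by (metis assms dot_lmul_matrix vector_transpose_matrix)

lemma orthonormal_eigenbasis_independent:
  assumes "orthonormal_eigenbasis M W S"
  shows "independent S" "finite S" "card S = dim W" "subspace W" "S \<subseteq> W"
proof -
  have "0 \<notin> S"
    using assms unfolding orthonormal_eigenbasis_def by force
  then show *: "independent S"
    using assms pairwise_orthogonal_independent unfolding orthonormal_eigenbasis_def by blast
  then show "finite S"
    by (rule independent_imp_finite)
  show "card S = dim W"
    using * assms dim_span_eq_card_independent unfolding orthonormal_eigenbasis_def by metis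
  show "subspace W" "S \<subseteq> W"
    using assms unfolding orthonormal_eigenbasis_def by (auto simp: span_base)
qed

lemma orthonormal_eigenbasis_inner:
  assumes "orthonormal_eigenbasis M W S" "a \<in> S" "b \<in> S"
  shows "a \<bullet> b = (if a = b then 1 else 0)"
  using assms unfolding orthonormal_eigenbasis_def pairwise_def orthogonal_def
  by (auto simp: norm_eq_1)

text \<open>A maximiser of the Rayleigh quotient on the unit sphere of an invariant subspace is an
  eigenvector, since the quotient is stationary there.\<close>

lemma exists_unit_eigenvector:
  fixes M :: "real^'n^'n"
  assumes M: "transpose M = M" and W: "subspace W" "\<And>x. x \<in> W \<Longrightarrow> M *v x \<in> W" "W \<noteq> {0}"
  obtains s where "s \<in> W" "norm s = 1" "M *v s = eigval M s *\<^sub>R s"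
proof -
  let ?q = "\<lambda>x. x \<bullet> (M *v x)"
  have "compact (sphere 0 1 \<inter> W)"
    using W by (intro compact_Int_closed closed_subspace) auto
  moreover have "sphere 0 1 \<inter> W \<noteq> {}"
  proof -
    obtain w where "w \<in> W" "w \<noteq> 0"
      using W subspace_0 by blast
    then have "w /\<^sub>R norm w \<in> sphere 0 1 \<inter> W"
      using W by (auto intro: subspace_scale)
    then show ?thesis
      by blast
  qed
  moreover have "continuous_on (sphere 0 1 \<inter> W) ?q"
    by (intro continuous_intros linear_continuous_on matrix_vector_mul_bounded_linear)
  ultimately obtain s where "s \<in> sphere 0 1 \<inter> W" and "\<forall>x\<in>sphere 0 1 \<inter> W. ?q x \<le> ?q s"
    using continuous_attains_sup[of "sphere 0 1 \<inter> W" ?q] by blast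
  then have s: "s \<in> W" "norm s = 1" and max: "\<And>x. x \<in> W \<Longrightarrow> norm x = 1 \<Longrightarrow> ?q x \<le> ?q s"
    by auto
  have le: "?q x \<le> ?q s * (norm x)\<^sup>2" if "x \<in> W" for x
  proof (cases "x = 0")
    case False
    have "?q (x /\<^sub>R norm x) \<le> ?q s"
      using that False W by (intro max) (auto intro: subspace_scale)
    then show ?thesis
      using False by (simp add: matrix_vector_mult_scaleR divide_simps power2_eq_square)
  qed simp
  define z where "z = M *v s - ?q s *\<^sub>R s"
  have z: "z \<in> W"
    unfolding z_def using W s by (auto intro: subspace_diff subspace_scale)
  have "z \<bullet> z = 0"
  proof -
    have "0 \<le> ?q s * (norm (s + t *\<^sub>R z))\<^sup>2 - ?q (s + t *\<^sub>R z)" for t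
      using le[of "s + t *\<^sub>R z"] z s W by (auto intro: subspace_add subspace_scale)
    moreover have "?q s * (norm (s + t *\<^sub>R z))\<^sup>2 - ?q (s + t *\<^sub>R z)
        = t * (t * (?q s * (z \<bullet> z) - ?q z) - 2 * (z \<bullet> z))" for t
    proof -
      have "s \<bullet> (M *v z) = z \<bullet> (M *v s)"
        by (metis symmetric_inner[OF M] inner_commute)
      moreover have "z \<bullet> (M *v s) = z \<bullet> z + ?q s * (z \<bullet> s)"
        by (simp add: z_def algebra_simps)
      moreover have "s \<bullet> s = 1"
        using s by (simp add: norm_eq_1)
      ultimately show ?thesis
        by (simp add: power2_norm_eq_inner matrix_vector_right_distrib matrix_vector_mult_scaleR
            inner_simps inner_commute algebra_simps)
    qed
    ultimately have pos: "0 \<le> t * (t * (?q s * (z \<bullet> z) - ?q z) - 2 * (z \<bullet> z))" for t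
      by simp
    show ?thesis
    proof (rule ccontr)
      assume "z \<bullet> z \<noteq> 0"
      then have zz: "0 < z \<bullet> z"
        by simp
      \<comment> \<open>For small t > 0 the linear term -2 t (z . z) must win. The value t = (z . z)
        / K is small enough, since the quadratic coefficient is below K; the summand 1 keeps K
        positive.\<close>
      define K where "K = \<bar>?q s * (z \<bullet> z) - ?q z\<bar> + 1"
      define t where "t = (z \<bullet> z) / K"
      have "K > 0"
        by (simp add: K_def)
      then have t: "t > 0" "t * K = z \<bullet> z"
        using zz by (simp_all add: t_def)
      have "t * (?q s * (z \<bullet> z) - ?q z) \<le> t * K"
        using t by (intro mult_left_mono) (auto simp: K_def)
      then have "t * (?q s * (z \<bullet> z) - ?q z) - 2 * (z \<bullet> z) < 0"
        using t zz by linarith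
      then show False
        using pos[of t] t by (metis mult_pos_neg not_le)
    qed
  qed
  then have "M *v s = eigval M s *\<^sub>R s"
    by (simp add: z_def eigval_def)
  with s show ?thesis
    using that by blast
qed

text \<open>The spectral theorem on an invariant subspace: split off one unit eigenvector s; by
  symmetry the vectors of W orthogonal to s again form an invariant subspace, of dimension one
  less.\<close>

lemma orthonormal_eigenbasis_exists:
  fixes M :: "real^'n^'n"
  assumes M: "transpose M = M" and W: "subspace W" "\<And>x. x \<in> W \<Longrightarrow> M *v x \<in> W"
  shows "\<exists>S. orthonormal_eigenbasis M W S"
  using W
proof (induction k \<equiv> "dim W" arbitrary: W)
  case 0
  then have "W = {0}"
    using subspace_0[of W] dim_eq_0[of W] by auto
  then show ?case
    by (intro exI[of _ "{}"]) (auto simp: orthonormal_eigenbasis_def)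
next
  case (Suc k)
  have "W \<noteq> {0}"
    using Suc.hyps(2) by auto
  then obtain s where s: "s \<in> W" "norm s = 1" "M *v s = eigval M s *\<^sub>R s"
    using exists_unit_eigenvector[OF M Suc.prems] by metis
  define W' where "W' = {y \<in> W. \<forall>x\<in>span {s}. orthogonal x y}"
  have W': "y \<in> W' \<longleftrightarrow> y \<in> W \<and> s \<bullet> y = 0" for y
    by (auto simp: W'_def orthogonal_def span_singleton)
  have "dim W' + dim (span {s}) = dim W"
    unfolding W'_def using s(1) Suc.prems(1)
    by (intro dim_subspace_orthogonal_to_vectors) (simp_all add: span_minimal)
  moreover have "dim (span {s}) = 1"
    using s by (metis dim_singleton dim_span norm_zero zero_neq_one)
  ultimately have "k = dim W'"
    using Suc.hyps by simp
  moreover have "subspace W'"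
    using Suc.prems(1) by (simp add: subspace_def W' inner_simps)
  moreover have "M *v y \<in> W'" if "y \<in> W'" for y
    using that Suc.prems(2) s(3) by (simp add: W' symmetric_inner[OF M])
  ultimately obtain S where S: "orthonormal_eigenbasis M W' S"
    using Suc.hyps(1) by blast
  have SW': "S \<subseteq> W'"
    using S by (rule orthonormal_eigenbasis_independent)
  have "pairwise orthogonal (insert s S)"
    using S SW' by (auto simp: orthonormal_eigenbasis_def pairwise_insert W' orthogonal_def
        inner_commute subset_eq)
  moreover have "span (insert s S) = W"
  proof
    show "span (insert s S) \<subseteq> W"
      using SW' s(1) Suc.prems(1) by (intro span_minimal) (auto simp: W')
    show "W \<subseteq> span (insert s S)"
    proof
      fix x assume "x \<in> W"
      then have "x - (s \<bullet> x) *\<^sub>R s \<in> W'"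
        using s(1,2) Suc.prems(1) by (simp add: W' inner_simps norm_eq_1 subspace_diff subspace_scale)
      then have "x - (s \<bullet> x) *\<^sub>R s \<in> span S"
        using S by (simp add: orthonormal_eigenbasis_def)
      then show "x \<in> span (insert s S)"
        using span_breakdown_eq[of x s S] by blast
    qed
  qed
  ultimately show ?case
    using S s by (intro exI[of _ "insert s S"]) (auto simp: orthonormal_eigenbasis_def)
qed

section \<open>Orthogonal complements and multiplicities of eigenvalues\<close>

definition orth_compl :: "(real^'n) set \<Rightarrow> (real^'n) set"
  where "orth_compl W = {y. \<forall>x\<in>W. orthogonal x y}"

lemma subspace_orth_compl: "subspace (orth_compl W)"
  by (auto simp: orth_compl_def subspace_def orthogonal_def inner_simps)

text \<open>Orthogonality makes the union independent, and its size is dim W plus the dimension of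
  the complement, that is n; so it spans.\<close>

lemma orthonormal_eigenbasis_Un:
  fixes M :: "real^'n^'n"
  assumes S: "orthonormal_eigenbasis M W S" and T: "orthonormal_eigenbasis M (orth_compl W) T"
  shows "orthonormal_eigenbasis M UNIV (S \<union> T)" "S \<inter> T = {}"
proof -
  have orth: "orthogonal s t" if "s \<in> S" "t \<in> T" for s t
    using that orthonormal_eigenbasis_independent(5)[OF S] orthonormal_eigenbasis_independent(5)[OF T]
    by (auto simp: orth_compl_def)
  then show disj: "S \<inter> T = {}"
    using S by (force simp: orthonormal_eigenbasis_def orthogonal_def)
  have pw: "pairwise orthogonal (S \<union> T)"
    using S T orth unfolding orthonormal_eigenbasis_def pairwise_def
    by (metis UnE orthogonal_commute)
  have "0 \<notin> S \<union> T"
    using S T by (force simp: orthonormal_eigenbasis_def)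
  with pw have ind: "independent (S \<union> T)"
    by (rule pairwise_orthogonal_independent)
  have "dim (orth_compl W) + dim W = dim (UNIV :: (real^'n) set)"
    using dim_subspace_orthogonal_to_vectors[of W UNIV] orthonormal_eigenbasis_independent(4)[OF S]
    by (simp add: orth_compl_def)
  then have "card (S \<union> T) = dim (UNIV :: (real^'n) set)"
    using S T disj by (simp add: card_Un_disjoint orthonormal_eigenbasis_independent)
  with ind have "span (S \<union> T) = UNIV"
    by (metis dim_eq_full dim_span_eq_card_independent dim_UNIV dim_span)
  with pw S T show "orthonormal_eigenbasis M UNIV (S \<union> T)"
    by (auto simp: orthonormal_eigenbasis_def)
qed

text \<open>Symmetry makes a mu-eigenvector orthogonal to every basis vector with another
  eigenvalue, so the basis vectors with eigenvalue mu already span the eigenspace.\<close>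

lemma dim_eigenspace:
  fixes M :: "real^'n^'n"
  assumes B: "orthonormal_eigenbasis M UNIV B" and M: "transpose M = M"
  shows "dim (eigenspace M \<mu>) = card {b \<in> B. eigval M b = \<mu>}"
proof -
  let ?C = "{b \<in> B. eigval M b = \<mu>}"
  have fin: "finite B" and ind: "independent B"
    using B by (simp_all add: orthonormal_eigenbasis_independent)
  have eig: "M *v b = eigval M b *\<^sub>R b" if "b \<in> B" for b
    using that B by (auto simp: orthonormal_eigenbasis_def)
  have "eigenspace M \<mu> = span ?C"
  proof
    show "span ?C \<subseteq> eigenspace M \<mu>"
      using eig by (intro span_minimal)
        (auto simp: eigenspace_def subspace_def matrix_vector_right_distrib
          matrix_vector_mult_scaleR scaleR_right_distrib)
    show "eigenspace M \<mu> \<subseteq> span ?C"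
    proof
      fix x assume "x \<in> eigenspace M \<mu>"
      then have x: "M *v x = \<mu> *\<^sub>R x"
        by (simp add: eigenspace_def)
      have "x \<bullet> b = 0" if "b \<in> B - ?C" for b
      proof -
        have "x \<bullet> (M *v b) = (M *v x) \<bullet> b"
          by (rule symmetric_inner[OF M])
        then have "eigval M b * (x \<bullet> b) = \<mu> * (x \<bullet> b)"
          using that x eig[of b] by simp
        then show ?thesis
          using that by auto
      qed
      moreover have "x = (\<Sum>b\<in>B. (x \<bullet> b) *\<^sub>R b)"
      proof -
        have "x \<in> span B"
          using B by (simp add: orthonormal_eigenbasis_def)
        then obtain u where u: "x = (\<Sum>b\<in>B. u b *\<^sub>R b)"
          using fin by (auto simp: span_finite)
        have "x \<bullet> b = u b" if "b \<in> B" for b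
          using that fin unfolding u
          by (simp add: inner_sum_left orthonormal_eigenbasis_inner[OF B] if_distrib cong: if_cong)
        then show ?thesis
          using u by (metis (no_types, lifting) sum.cong)
      qed
      ultimately have "x = (\<Sum>b\<in>?C. (x \<bullet> b) *\<^sub>R b)"
        using fin by (metis (no_types, lifting) mem_Collect_eq scaleR_zero_left subsetI sum.mono_neutral_right)
      then show "x \<in> span ?C"
        by (metis (no_types, lifting) span_base span_scale span_sum)
    qed
  qed
  then show ?thesis
    using dim_span_eq_card_independent[of ?C] independent_mono[OF ind] by auto
qed

text \<open>\<open>singular_values\<close> is defined by eigenspace dimensions; this reads it off
  any eigenbasis, where multiplicity is the number of basis vectors sharing an eigenvalue. The
  eigenvalues are compared as multisets first, and the square root is applied at the end.\<close>

lemma singular_values_eq_eigenbasis: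
  fixes A :: "real^'n^'m"
  defines "M \<equiv> transpose A ** A"
  assumes B: "orthonormal_eigenbasis M UNIV B"
  shows "singular_values A = image_mset (\<lambda>b. sqrt (eigval M b)) (mset_set B)"
proof -
  have M: "transpose M = M"
    by (simp add: M_def matrix_transpose_mul)
  have fin: "finite B"
    using B by (rule orthonormal_eigenbasis_independent)
  have dim: "dim (eigenspace M \<mu>) = card {b \<in> B. eigval M b = \<mu>}" for \<mu>
    using B M by (rule dim_eigenspace)
  have "eigenspace M \<mu> \<noteq> {0} \<longleftrightarrow> dim (eigenspace M \<mu>) \<noteq> 0" for \<mu>
    by (auto simp: eigenspace_def dim_eq_0)
  then have K: "{\<mu>. eigenspace M \<mu> \<noteq> {0}} = eigval M ` B"
    using fin by (auto simp: dim)
  have *: "image_mset (eigval M) (mset_set B)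
      = (\<Sum>\<mu>\<in>eigval M ` B. replicate_mset (dim (eigenspace M \<mu>)) \<mu>)"
  proof (rule multiset_eqI)
    fix x
    have "count (\<Sum>\<mu>\<in>eigval M ` B. replicate_mset (dim (eigenspace M \<mu>)) \<mu>) x
        = (\<Sum>\<mu>\<in>eigval M ` B. if x = \<mu> then dim (eigenspace M \<mu>) else 0)"
      by (simp add: count_sum)
    also have "\<dots> = card {b \<in> B. eigval M b = x}"
      using fin by (auto simp: dim)
    also have "\<dots> = count (image_mset (eigval M) (mset_set B)) x"
      using fin by (simp add: count_image_mset_eq_card_vimage)
    finally show "count (image_mset (eigval M) (mset_set B)) x
        = count (\<Sum>\<mu>\<in>eigval M ` B. replicate_mset (dim (eigenspace M \<mu>)) \<mu>) x" ..
  qed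
  have "singular_values A = (\<Sum>\<mu>\<in>eigval M ` B. image_mset sqrt (replicate_mset (dim (eigenspace M \<mu>)) \<mu>))"
    by (simp add: singular_values_def K flip: M_def)
  also have "\<dots> = image_mset sqrt (\<Sum>\<mu>\<in>eigval M ` B. replicate_mset (dim (eigenspace M \<mu>)) \<mu>)"
    by (subst sum_comp_morphism[of "image_mset sqrt", symmetric]) (simp_all add: comp_def)
  finally show ?thesis
    by (simp flip: * add: image_mset.compositionality comp_def)
qed

section \<open>The determinant quotient\<close>

text \<open>An arbitrary square M replaces the Gram matrix of A so that \<open>mat 1\<close> is an
  admissible choice: numerator and denominator are then instances of the same identities.\<close>

definition det_quot :: "real^'n^'n \<Rightarrow> real^'p^'n \<Rightarrow> real"
  where "det_quot M X = det (transpose X ** M ** X) / det (transpose X ** X)"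

lemma f_det_eq_det_quot: "f_det A = det_quot (transpose A ** A)"
  by (rule ext) (simp add: f_det_def det_quot_def matrix_mul_assoc)

lemma span_columns: "span (columns X) = range ((*v) X)" for X :: "real^'p^'n"
proof -
  have "span (columns X) = vec.span (columns X)"
    by (simp add: span_vec_eq)
  also have "columns X = (*v) X ` range (\<lambda>i. axis i 1)"
    by (rule columns_image_basis)
  finally show ?thesis
  proof -
    have "range ((*v) X) \<subseteq> span (columns X)"
      using matrix_vector_mult_in_columnspace by blast
    moreover have "span (columns X) \<subseteq> range ((*v) X)"
      by (intro span_minimal subspace_UNIV matrix_vector_mul_linear linear_subspace_image) (auto simp: columns_image_basis)
    ultimately show ?thesis
      by blast
  qed
qed

lemma inner_transpose_mult: "(transpose X *v v) \<bullet> x = v \<bullet> (X *v x)" for X :: "real^'p^'n"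
  by (simp add: dot_lmul_matrix)

lemma orth_compl_columns_iff:
  "v \<in> orth_compl (span (columns X)) \<longleftrightarrow> transpose X *v v = 0" for X :: "real^'p^'n"
proof -
  have "v \<in> orth_compl (span (columns X)) \<longleftrightarrow> (\<forall>x. (transpose X *v v) \<bullet> x = 0)"
    unfolding inner_transpose_mult
    by (auto simp: orth_compl_def span_columns orthogonal_def inner_commute)
  then show ?thesis
    by (metis inner_eq_zero_iff inner_zero_left)
qed

text \<open>x . (X^T X x) is the squared norm of X x, so X and X^T X have the same kernel.\<close>

lemma full_rank_iff: "X \<in> full_rank \<longleftrightarrow> det (transpose X ** X) \<noteq> 0" for X :: "real^'p^'n"
proof -
  have "X *v x = 0" if "(transpose X ** X) *v x = 0" for x
  proof -
    have "(X *v x) \<bullet> (X *v x) = x \<bullet> ((transpose X ** X) *v x)"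
      by (metis dot_lmul_matrix inner_commute matrix_vector_mul_assoc transpose_transpose vector_transpose_matrix)
    then show ?thesis
      using that by simp
  qed
  then have "inj ((*v) X) \<longleftrightarrow> inj ((*v) (transpose X ** X))"
    by (metis matrix_left_invertible_injective matrix_left_invertible_ker matrix_vector_mul_assoc
        matrix_vector_mult_0_right)
  also have "\<dots> \<longleftrightarrow> det (transpose X ** X) \<noteq> 0"
    by (metis invertible_det_nz invertible_left_inverse matrix_left_invertible_injective)
  finally show ?thesis
    by (simp add: full_rank_def full_rank_injective)
qed

lemma det_sandwich:
  "det (transpose (Y ** G) ** M ** (Y ** G)) = (det G)\<^sup>2 * det (transpose Y ** M ** Y)"
  for Y :: "real^'p^'n"
proof -
  have "transpose (Y ** G) ** M ** (Y ** G) = transpose G ** (transpose Y ** M ** Y) ** G"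
    by (simp add: matrix_transpose_mul matrix_mul_assoc)
  then show ?thesis
    by (simp add: det_mul power2_eq_square)
qed

text \<open>Each column of X is a combination of columns of Y, so X = Y G, and the square of det G
  cancels in the quotient. It is nonzero because X has full rank.\<close>

lemma det_quot_same_span:
  fixes X Y :: "real^'p^'n"
  assumes X: "X \<in> full_rank" and XY: "span (columns X) = span (columns Y)"
  shows "Y \<in> full_rank" "det_quot M X = det_quot M Y"
proof -
  show "Y \<in> full_rank"
    using assms dim_span unfolding full_rank_def column_rank_def mem_Collect_eq by metis
  have "\<exists>g. column j X = Y *v g" for j
    using XY span_base[of "column j X" "columns X"] unfolding span_columns[of Y]
    by (auto simp: columns_def)
  then obtain g where g: "column j X = Y *v g j" for j
    by metis
  define G where "G = (\<chi> i j. g j $ i)"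
  have "column j (Y ** G) = Y *v g j" for j
    by (simp add: G_def matrix_matrix_mult_def matrix_vector_mult_def column_def)
  then have "column j (Y ** G) = column j X" for j
    by (simp add: g)
  then have G: "X = Y ** G"
    by (simp add: vec_eq_iff column_def)
  have "det (transpose X ** X) = (det G)\<^sup>2 * det (transpose Y ** Y)"
    using det_sandwich[of Y G "mat 1"] by (simp add: G)
  moreover have "det (transpose X ** M ** X) = (det G)\<^sup>2 * det (transpose Y ** M ** Y)"
    unfolding G by (rule det_sandwich)
  ultimately show "det_quot M X = det_quot M Y"
    using X by (simp add: det_quot_def full_rank_iff)
qed

text \<open>The columns are indexed by a type, so a bijection c takes the place of an ordering of S.
  In this basis the matrices of numerator and denominator are both diagonal.\<close>

lemma eigenbasis_matrix:
  fixes M :: "real^'n^'n"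
  assumes S: "orthonormal_eigenbasis M W S" and c: "bij_betw c (UNIV :: 'p::finite set) S"
  defines "Q \<equiv> \<chi> i j. c j $ i"
  shows "column j Q = c j" "orthonormal_columns Q" "span (columns Q) = W"
    "Q \<in> full_rank" "det_quot M Q = (\<Prod>s\<in>S. eigval M s)"
proof -
  have col: "column j Q = c j" for j
    by (simp add: column_def Q_def vec_eq_iff)
  then show "column j Q = c j" .
  have cS: "c j \<in> S" for j
    using c by (auto simp: bij_betw_def)
  have entry: "(transpose Q ** N ** Q) $ i $ j = c i \<bullet> (N *v c j)" for i j and N :: "real^'n^'n"
    unfolding matrix_mul_assoc[symmetric]
    by (simp add: Q_def matrix_matrix_mult_def transpose_def matrix_vector_mult_def inner_vec_def)
  have cc: "c i \<bullet> c j = (if i = j then 1 else 0)" for i j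
    using orthonormal_eigenbasis_inner[OF S cS cS] c by (auto simp: bij_betw_def inj_def)
  have "(transpose Q ** Q) $ i $ j = c i \<bullet> c j" for i j
    using entry[where N = "mat 1"] by simp
  then show *: "orthonormal_columns Q"
    by (simp add: orthonormal_columns_def vec_eq_iff cc mat_def)
  then show "Q \<in> full_rank"
    by (simp add: full_rank_iff orthonormal_columns_def)
  have "columns Q = S"
    using c by (auto simp: columns_def col bij_betw_def)
  then show "span (columns Q) = W"
    using S by (simp add: orthonormal_eigenbasis_def)
  have "(transpose Q ** M ** Q) $ i $ j = (if i = j then eigval M (c j) else 0)" for i j
  proof -
    have "M *v c j = eigval M (c j) *\<^sub>R c j"
      using S cS by (auto simp: orthonormal_eigenbasis_def)
    then show ?thesis
      by (simp add: entry cc)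
  qed
  then have "det (transpose Q ** M ** Q) = (\<Prod>j\<in>UNIV. eigval M (c j))"
    by (subst det_diagonal) auto
  also have "\<dots> = (\<Prod>s\<in>S. eigval M s)"
    using c by (rule prod.reindex_bij_betw)
  finally show "det_quot M Q = (\<Prod>s\<in>S. eigval M s)"
    using * by (simp add: det_quot_def orthonormal_columns_def)
qed

lemma det_quot_eigenbasis:
  fixes X :: "real^'p^'n"
  assumes X: "X \<in> full_rank" and S: "orthonormal_eigenbasis M (span (columns X)) S"
  shows "card S = CARD('p)" "det_quot M X = (\<Prod>s\<in>S. eigval M s)"
proof -
  show card: "card S = CARD('p)"
    using X S by (simp add: full_rank_def column_rank_def orthonormal_eigenbasis_independent)
  then obtain c where "bij_betw c (UNIV :: 'p set) S"
    using finite_same_card_bij[of "UNIV :: 'p set" S] S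
    by (auto simp: orthonormal_eigenbasis_independent)
  from eigenbasis_matrix[OF S this] show "det_quot M X = (\<Prod>s\<in>S. eigval M s)"
    using det_quot_same_span[OF X] by metis
qed

lemma eigval_gram_nonneg: "0 \<le> eigval (transpose A ** A) s"
proof -
  have "eigval (transpose A ** A) s = (A *v s) \<bullet> (A *v s)"
    unfolding eigval_def
    by (metis dot_lmul_matrix inner_commute matrix_vector_mul_assoc transpose_transpose vector_transpose_matrix)
  then show ?thesis
    by simp
qed

text \<open>At \<open>X = mat 1\<close> the quotient of a Gram matrix is its determinant, hence a
  product of nonnegative eigenvalues.\<close>

lemma det_gram_nonneg: "0 \<le> det (transpose C ** C)" for C :: "real^'p^'m"
proof -
  let ?P = "transpose C ** C"
  obtain S where S: "orthonormal_eigenbasis ?P UNIV S"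
    using orthonormal_eigenbasis_exists[of ?P UNIV] by (auto simp: matrix_transpose_mul)
  have I: "mat 1 \<in> (full_rank :: (real^'p^'p) set)"
    by (simp add: full_rank_def rank_I)
  have "span (columns (mat 1 :: real^'p^'p)) = UNIV"
    by (auto simp: span_columns)
  with S have "det_quot ?P (mat 1 :: real^'p^'p) = (\<Prod>s\<in>S. eigval ?P s)"
    by (intro det_quot_eigenbasis(2)[OF I]) simp
  then show ?thesis
    by (simp add: det_quot_def prod_nonneg eigval_gram_nonneg)
qed

lemma f_det_nonneg: "0 \<le> f_det A X"
proof -
  have "transpose X ** transpose A ** A ** X = transpose (A ** X) ** (A ** X)"
    by (simp add: matrix_transpose_mul matrix_mul_assoc)
  then show ?thesis
    by (simp add: f_det_def det_gram_nonneg)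
qed

section \<open>Smoothness of the quotient on the open set of full-rank matrices\<close>

lemma twice_differentiable_on_det_sandwich:
  "twice_differentiable_on (\<lambda>X :: real^'p^'n. det (transpose X ** M ** X)) S"
proof (rule twice_differentiable_on_det)
  show "twice_differentiable_on (\<lambda>X :: real^'p^'n. (transpose X ** M ** X) $ i $ j) S" for i j
    unfolding matrix_matrix_mult_def transpose_def vec_lambda_beta
    by (intro twice_differentiable_on_sum twice_differentiable_on_mult
        twice_differentiable_on_const twice_differentiable_on_entry)
qed

lemma twice_differentiable_on_imp_continuous_on:
  "twice_differentiable_on f S \<Longrightarrow> continuous_on S f"
  unfolding twice_differentiable_on_def
  by (metis continuous_at_imp_continuous_on has_derivative_continuous)

lemma open_full_rank: "open (full_rank :: (real^'p^'n) set)"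
proof -
  have "continuous_on UNIV (\<lambda>X :: real^'p^'n. det (transpose X ** X))"
    using twice_differentiable_on_det_sandwich[of "mat 1"]
    by (auto intro!: twice_differentiable_on_imp_continuous_on)
  then have "open ((\<lambda>X :: real^'p^'n. det (transpose X ** X)) -` (- {0}))"
    by (intro open_vimage) auto
  then show ?thesis
    by (simp add: vimage_def flip: full_rank_iff)
qed

lemma twice_differentiable_on_det_quot: "twice_differentiable_on (det_quot M) full_rank"
proof -
  have "twice_differentiable_on (\<lambda>X :: real^'p^'n. det (transpose X ** X)) S" for S
    using twice_differentiable_on_det_sandwich[of "mat 1"] by simp
  then show ?thesis
    unfolding det_quot_def divide_inverse
    by (intro twice_differentiable_on_mult twice_differentiable_on_det_sandwich
        twice_differentiable_on_inverse) (auto simp: full_rank_iff)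
qed

text \<open>Used with two kinds of z in the complement of the range. For an eigenvector z of M the
  linear term vanishes, which leaves a rank-one change; for general z the vector X^T M z in that
  term measures how far M z leaves the complement.\<close>

lemma sandwich_add_outer:
  fixes M :: "real^'n^'n" and X :: "real^'p^'n"
  assumes M: "transpose M = M"
  shows "transpose (X + t *\<^sub>R outer z y) ** M ** (X + t *\<^sub>R outer z y) =
    transpose X ** M ** X
      + t *\<^sub>R (outer y (transpose X *v (M *v z)) + outer (transpose X *v (M *v z)) y)
      + (t\<^sup>2 * (z \<bullet> (M *v z))) *\<^sub>R outer y y"
proof -
  have tr: "transpose (X + t *\<^sub>R outer z y) = transpose X + t *\<^sub>R outer y z"
    by (simp add: transpose_def outer_def vec_eq_iff mult_ac)
  have add: "(P + t *\<^sub>R Q) ** C = P ** C + t *\<^sub>R (Q ** C)"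
    for P Q :: "real^'a^'b" and C :: "real^'c^'a"
    by (simp add: matrix_matrix_mult_def vec_eq_iff sum.distrib sum_distrib_left algebra_simps)
  have add': "C ** (P + t *\<^sub>R Q) = C ** P + t *\<^sub>R (C ** Q)"
    for P Q :: "real^'a^'b" and C :: "real^'b^'c"
    by (simp add: matrix_matrix_mult_def vec_eq_iff sum.distrib sum_distrib_left algebra_simps)
  have "transpose X ** M ** outer z y = outer (transpose X *v (M *v z)) y"
    by (simp only: matrix_mul_outer matrix_vector_mul_assoc)
  moreover have "outer y z ** M ** X = outer y (transpose X *v (M *v z))"
    by (simp only: outer_matrix_mul M)
  moreover have "outer y z ** M ** outer z y = (z \<bullet> (M *v z)) *\<^sub>R outer y y"
    by (simp only: matrix_mul_outer outer_matrix_mul M outer_mult_vector outer_scaleR inner_commute)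
  ultimately show ?thesis
    unfolding tr add add' by (simp add: scaleR_right_distrib power2_eq_square)
qed

text \<open>Adding a multiple of \<open>v (X\<^sup>T u)\<^sup>T\<close> to \<open>X\<close> applies \<open>I + t v u\<^sup>T\<close> to it, i.e. it moves the
  direction \<open>u\<close> of the range of \<open>X\<close> towards \<open>v\<close>.\<close>

lemma det_exchange:
  fixes M :: "real^'n^'n" and X :: "real^'p^'n"
  assumes M: "transpose M = M"
    and u: "u \<in> span (columns X)" "norm u = 1" "M *v u = \<alpha> *\<^sub>R u" "\<alpha> \<noteq> 0"
    and v: "v \<in> orth_compl (span (columns X))" "norm v = 1" "M *v v = \<beta> *\<^sub>R v"
  defines "Y \<equiv> \<lambda>t. X + t *\<^sub>R outer v (transpose X *v u)"
  shows "det (transpose (Y t) ** M ** Y t) = det (transpose X ** M ** X) * (1 + t\<^sup>2 * \<beta> / \<alpha>)"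
proof -
  let ?y = "transpose X *v u"
  obtain w where w: "u = X *v w"
    using u by (auto simp: span_columns)
  have Xv: "v v* X = 0"
    using v(1) by (simp add: orth_compl_columns_iff)
  have "transpose (Y t) ** M ** Y t = transpose X ** M ** X + outer ((t\<^sup>2 * \<beta>) *\<^sub>R ?y) ?y"
    using v by (simp add: Y_def sandwich_add_outer[OF M] matrix_vector_mult_scaleR Xv outer_scaleR
        outer_zero norm_eq_1)
  moreover have "(transpose X ** M ** X) *v ((t\<^sup>2 * \<beta> / \<alpha>) *\<^sub>R w) = (t\<^sup>2 * \<beta>) *\<^sub>R ?y"
    using u by (simp add: matrix_vector_mult_scaleR matrix_vector_mul_assoc[symmetric] flip: w)
  moreover have "?y \<bullet> w = 1"
    using u by (metis dot_lmul_matrix norm_eq_1 vector_transpose_matrix w transpose_transpose)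
  ultimately show ?thesis
    by (simp add: det_add_outer)
qed

text \<open>For the denominator take \<open>mat 1\<close>, of which u and v are eigenvectors with
  eigenvalue 1.\<close>

lemma det_quot_exchange:
  fixes M :: "real^'n^'n" and X :: "real^'p^'n"
  assumes "transpose M = M"
    and u: "u \<in> span (columns X)" "norm u = 1" "M *v u = \<alpha> *\<^sub>R u" "\<alpha> \<noteq> 0"
    and v: "v \<in> orth_compl (span (columns X))" "norm v = 1" "M *v v = \<beta> *\<^sub>R v"
  shows "det_quot M (X + t *\<^sub>R outer v (transpose X *v u))
    = det_quot M X * ((1 + t\<^sup>2 * \<beta> / \<alpha>) / (1 + t\<^sup>2))"
  using det_exchange[OF assms] det_exchange[of "mat 1" u X 1 v 1] u v
  by (simp add: det_quot_def)

lemma hessian_det_quot_exchange: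
  fixes M :: "real^'n^'n" and X :: "real^'p^'n"
  assumes X: "X \<in> full_rank" and "transpose M = M"
    and "u \<in> span (columns X)" "norm u = 1" "M *v u = \<alpha> *\<^sub>R u" "\<alpha> \<noteq> 0"
    and "v \<in> orth_compl (span (columns X))" "norm v = 1" "M *v v = \<beta> *\<^sub>R v"
  defines "D \<equiv> outer v (transpose X *v u)"
  shows "hessian (det_quot M) X D D = det_quot M X * (\<beta> / \<alpha> - 1)"
proof -
  let ?g = "\<lambda>t. det_quot M X * ((1 + t\<^sup>2 * \<beta> / \<alpha>) / (1 + t\<^sup>2))"
  \<comment> \<open>The quotient rule, with r = beta / alpha, gives 2 t (r - 1) / (1 + t^2)^2. Its
    derivative at 0 is 2 (r - 1), and the normalisation of \<open>hessian\<close> cancels the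
    2.\<close>
  let ?g' = "\<lambda>t. det_quot M X * (2 * t * (\<beta> / \<alpha> - 1) / (1 + t\<^sup>2)\<^sup>2)"
  have pos: "1 + t\<^sup>2 \<noteq> 0" for t :: real
    by (metis add_pos_nonneg less_irrefl zero_le_power2 zero_less_one)
  have "(?g has_real_derivative ?g' t) (at t)" for t
    using pos[of t] assms(6)
    by (auto intro!: derivative_eq_intros simp: divide_simps) (simp add: power2_eq_square algebra_simps)
  moreover have "(?g' has_real_derivative 2 * (det_quot M X * (\<beta> / \<alpha> - 1))) (at 0)"
    by (auto intro!: derivative_eq_intros)
  ultimately have "hessian (det_quot M) X D D = 2 * (det_quot M X * (\<beta> / \<alpha> - 1)) / 2"
    using det_quot_exchange[OF assms(2-9)] unfolding D_def
    by (intro hessian_along_line[OF open_full_rank X twice_differentiable_on_det_quot])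
  then show ?thesis
    by simp
qed

section \<open>Stationary points and leading singular subspaces\<close>

lemma det_has_derivative:
  fixes B :: "real^'n^'n"
  obtains d where "(det has_derivative d) (at B)"
proof -
  have "twice_differentiable_on (det :: real^'n^'n \<Rightarrow> real) UNIV"
    using twice_differentiable_on_det[of "\<lambda>X. X" UNIV] twice_differentiable_on_entry by blast
  then show ?thesis
    using that unfolding twice_differentiable_on_def by blast
qed

text \<open>Jacobi's formula in rank-one directions. Along such a line the determinant is affine in
  t, so the derivative can be read off.\<close>

lemma det_derivative_outer:
  fixes B :: "real^'n^'n"
  assumes d: "(det has_derivative d) (at B)" and w: "B *v w = a"
  shows "d (outer a b) = det B * (b \<bullet> w)"
proof -
  have "((\<lambda>t. B + t *\<^sub>R outer a b) has_derivative (\<lambda>t. t *\<^sub>R outer a b)) (at 0)"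
    by (auto intro!: derivative_eq_intros)
  with d have "((\<lambda>t. det (B + t *\<^sub>R outer a b)) has_derivative (\<lambda>t. d (t *\<^sub>R outer a b))) (at 0)"
    using diff_chain_at[of "\<lambda>t. B + t *\<^sub>R outer a b" _ 0 det d] by (simp add: o_def)
  moreover have "det (B + t *\<^sub>R outer a b) = det B * (1 + t * (b \<bullet> w))" for t
    using det_add_outer[of B "t *\<^sub>R w" "t *\<^sub>R a" b] w
    by (simp add: matrix_vector_mult_scaleR outer_scaleR)
  ultimately have "((\<lambda>t. det B * (1 + t * (b \<bullet> w))) has_derivative (\<lambda>t. d (t *\<^sub>R outer a b))) (at 0)"
    by simp
  moreover have "((\<lambda>t. det B * (1 + t * (b \<bullet> w))) has_derivative (\<lambda>t. det B * (t * (b \<bullet> w)))) (at 0)"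
    by (auto intro!: derivative_eq_intros)
  ultimately have "(\<lambda>t. d (t *\<^sub>R outer a b)) = (\<lambda>t. det B * (t * (b \<bullet> w)))"
    by (rule has_derivative_unique)
  from fun_cong[OF this, of 1] show ?thesis
    by simp
qed

text \<open>A preimage of B c is c, and a preimage w of c satisfies (B c) . w = c . (B w) = c . c by
  symmetry; so both summands contribute the same amount.\<close>

lemma det_derivative_symmetric_outer:
  fixes B :: "real^'n^'n"
  assumes d: "(det has_derivative d) (at B)" and B: "transpose B = B" "det B \<noteq> 0"
  shows "d (outer (B *v c) c + outer c (B *v c)) = 2 * det B * (c \<bullet> c)"
proof -
  obtain w where w: "B *v w = c"
    using B(2) invertible_det_nz invertible_right_inverse matrix_vector_mul_assoc
      matrix_vector_mul_lid by metis
  have "linear d"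
    using d has_derivative_linear by blast
  then have "d (outer (B *v c) c + outer c (B *v c)) = d (outer (B *v c) c) + d (outer c (B *v c))"
    by (rule linear_add)
  also have "(B *v c) \<bullet> w = c \<bullet> c"
    using symmetric_inner[OF B(1), of c w] w by simp
  then have "d (outer c (B *v c)) = det B * (c \<bullet> c)"
    using det_derivative_outer[OF d w, of "B *v c"] by simp
  also have "d (outer (B *v c) c) = det B * (c \<bullet> c)"
    using det_derivative_outer[OF d refl] by simp
  finally show ?thesis
    by simp
qed

text \<open>With \<open>B = X\<^sup>T M X\<close> and \<open>c = X\<^sup>T M v\<close>, moving \<open>X\<close> along \<open>v (B c)\<^sup>T\<close> leaves \<open>X\<^sup>T X\<close> unchanged to
  first order and changes the determinant of \<open>B\<close> at the rate \<open>2 (det B) (c \<bullet> c)\<close>, so \<open>c = 0\<close>.\<close>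

lemma stationary_imp_orth_compl_invariant:
  fixes M :: "real^'n^'n" and X :: "real^'p^'n"
  assumes M: "transpose M = M" and X: "X \<in> full_rank" and nz: "det_quot M X \<noteq> 0"
    and stat: "(det_quot M has_derivative (\<lambda>_. 0)) (at X)"
    and v: "v \<in> orth_compl (span (columns X))"
  shows "M *v v \<in> orth_compl (span (columns X))"
proof -
  define B where "B = transpose X ** M ** X"
  define G where "G = transpose X ** X"
  define c where "c = transpose X *v (M *v v)"
  \<comment> \<open>A general y changes the determinant at the rate 2 (det B) (c . w) with B w = y;
    choosing w = c makes c . w a sum of squares.\<close>
  define y where "y = B *v c"
  have B: "transpose B = B" "det B \<noteq> 0"
    using nz by (auto simp: B_def matrix_transpose_mul M matrix_mul_assoc det_quot_def)
  have G: "det G \<noteq> 0"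
    using X by (simp add: G_def full_rank_iff)
  have Xv: "v v* X = 0"
    using v by (simp add: orth_compl_columns_iff)
  let ?Y = "\<lambda>t. X + t *\<^sub>R outer v y"
  have line: "((\<lambda>t. det (P + t *\<^sub>R Q + (t\<^sup>2 * k) *\<^sub>R outer y y)) has_real_derivative e Q) (at 0)"
    if "(det has_derivative e) (at P)" for P Q :: "real^'p^'p" and k e
  proof -
    let ?h = "\<lambda>t :: real. P + t *\<^sub>R Q + (t\<^sup>2 * k) *\<^sub>R outer y y"
    have "(?h has_derivative (\<lambda>t. t *\<^sub>R Q)) (at 0)"
      by (auto intro!: derivative_eq_intros)
    with that have "((\<lambda>t. det (?h t)) has_derivative (\<lambda>t. e (t *\<^sub>R Q))) (at 0)"
      using diff_chain_at[of ?h _ 0 det e] by (simp add: o_def)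
    moreover have "e (t *\<^sub>R Q) = t * e Q" for t
      using has_derivative_linear[OF that] by (simp add: linear_scale)
    ultimately show ?thesis
      unfolding has_field_derivative_def by (simp add: mult_commute_abs)
  qed
  obtain d where d: "(det has_derivative d) (at B)"
    by (rule det_has_derivative)
  obtain d' where d': "(det has_derivative d') (at G)"
    by (rule det_has_derivative)
  have "transpose (?Y t) ** M ** ?Y t
      = B + t *\<^sub>R (outer y c + outer c y) + (t\<^sup>2 * (v \<bullet> (M *v v))) *\<^sub>R outer y y" for t
    unfolding sandwich_add_outer[OF M] B_def c_def ..
  then have N: "((\<lambda>t. det (transpose (?Y t) ** M ** ?Y t)) has_real_derivative
      2 * det B * (c \<bullet> c)) (at 0)"
    using line[OF d, of "outer y c + outer c y"] det_derivative_symmetric_outer[OF d B, of c]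
    by (simp add: y_def)
  have "transpose (?Y t) ** ?Y t = G + t *\<^sub>R 0 + (t\<^sup>2 * (v \<bullet> v)) *\<^sub>R outer y y" for t
    using sandwich_add_outer[of "mat 1" X t v y] by (simp add: G_def Xv outer_zero)
  moreover have "d' 0 = 0"
    using has_derivative_linear[OF d'] linear_0 by blast
  ultimately have D: "((\<lambda>t. det (transpose (?Y t) ** ?Y t)) has_real_derivative 0) (at 0)"
    using line[OF d', of 0] by simp
  have Y0: "transpose (?Y 0) ** M ** ?Y 0 = B" "transpose (?Y 0) ** ?Y 0 = G"
    by (simp_all add: B_def G_def)
  have "((\<lambda>t. det_quot M (?Y t)) has_real_derivative 2 * det B * (c \<bullet> c) / det G) (at 0)"
    unfolding det_quot_def
    using DERIV_divide[OF N D] G unfolding Y0 by (simp add: field_simps power2_eq_square)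
  moreover have "((\<lambda>t. det_quot M (?Y t)) has_real_derivative 0) (at 0)"
  proof -
    have "(?Y has_derivative (\<lambda>t. t *\<^sub>R outer v y)) (at 0)"
      by (auto intro!: derivative_eq_intros)
    then have "((\<lambda>t. det_quot M (?Y t)) has_derivative (\<lambda>_. 0)) (at 0)"
      using diff_chain_at[of ?Y _ 0 "det_quot M" "\<lambda>_. 0"] stat by (simp add: o_def)
    then show ?thesis
      by (simp add: has_field_derivative_def lambda_zero)
  qed
  ultimately have "2 * det B * (c \<bullet> c) / det G = 0"
    by (rule DERIV_unique)
  then have "c = 0"
    using B G by simp
  then show ?thesis
    unfolding orth_compl_columns_iff c_def .
qed

text \<open>Invariance passes from the complement to the range by symmetry: if b is the component of
  M x in the complement, then b . b = b . (M x) = (M b) . x = 0.\<close>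

lemma stationary_eigenbases:
  fixes M :: "real^'n^'n" and X :: "real^'p^'n"
  assumes M: "transpose M = M" and X: "X \<in> full_rank" and "det_quot M X \<noteq> 0"
    and "(det_quot M has_derivative (\<lambda>_. 0)) (at X)"
  obtains S T where "orthonormal_eigenbasis M (span (columns X)) S"
    "orthonormal_eigenbasis M (orth_compl (span (columns X))) T"
proof -
  let ?W = "span (columns X)"
  have inv: "M *v v \<in> orth_compl ?W" if "v \<in> orth_compl ?W" for v
    using stationary_imp_orth_compl_invariant[OF assms that] .
  have "M *v x \<in> ?W" if x: "x \<in> ?W" for x
  proof -
    obtain a b where ab: "M *v x = a + b" "a \<in> ?W" "\<And>w. w \<in> ?W \<Longrightarrow> orthogonal b w"
      using orthogonal_subspace_decomp_exists[of "columns X" "M *v x"] by blast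
    then have b: "b \<in> orth_compl ?W"
      by (simp add: orth_compl_def orthogonal_commute)
    have "b \<bullet> (M *v x) = (M *v b) \<bullet> x"
      by (rule symmetric_inner[OF M])
    also have "\<dots> = 0"
      using inv[OF b] x by (simp add: orth_compl_def orthogonal_def inner_commute)
    finally have "b \<bullet> b = 0"
      using ab(1) ab(3)[OF ab(2)] by (simp add: inner_right_distrib orthogonal_def)
    then show ?thesis
      using ab by simp
  qed
  then have "\<exists>S. orthonormal_eigenbasis M ?W S"
    by (intro orthonormal_eigenbasis_exists[OF M]) simp_all
  moreover have "\<exists>T. orthonormal_eigenbasis M (orth_compl ?W) T"
    by (intro orthonormal_eigenbasis_exists[OF M] subspace_orth_compl inv)
  ultimately show ?thesis
    using that by blast
qed

text \<open>The exchange formula is exact, so a single nonzero t close to 0 gives the inequality,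
  without second derivatives. The sign of k decides between maxima and minima.\<close>

lemma exchange_eigval_le:
  fixes M :: "real^'n^'n" and X :: "real^'p^'n"
  assumes M: "transpose M = M" and pos: "0 < det_quot M X" "0 < \<alpha>"
    and u: "u \<in> span (columns X)" "norm u = 1" "M *v u = \<alpha> *\<^sub>R u"
    and v: "v \<in> orth_compl (span (columns X))" "norm v = 1" "M *v v = \<beta> *\<^sub>R v"
    and opt: "\<forall>\<^sub>F Y in nhds X. k * det_quot M Y \<le> k * det_quot M X"
  shows "k * \<beta> \<le> k * \<alpha>"
proof -
  let ?Y = "\<lambda>t. X + t *\<^sub>R outer v (transpose X *v u)"
  have "isCont ?Y 0"
    by (intro continuous_intros)
  then have "(?Y \<longlongrightarrow> X) (at 0)"
    by (simp add: isCont_def)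
  with opt have "\<forall>\<^sub>F t in at 0. k * det_quot M (?Y t) \<le> k * det_quot M X"
    by (rule eventually_compose_filterlim)
  then have "\<forall>\<^sub>F t in at 0. k * det_quot M (?Y t) \<le> k * det_quot M X \<and> t \<noteq> 0"
    by (rule eventually_conj) (simp add: eventually_at_filter)
  then obtain t where t: "k * det_quot M (?Y t) \<le> k * det_quot M X" "t \<noteq> 0"
    using eventually_happens'[OF at_neq_bot] by blast
  have q: "0 < 1 + t\<^sup>2"
    by (simp add: add_pos_nonneg)
  have "det_quot M (?Y t) = det_quot M X * ((1 + t\<^sup>2 * \<beta> / \<alpha>) / (1 + t\<^sup>2))"
    using pos by (intro det_quot_exchange M u v) auto
  with t have "det_quot M X * (k * ((1 + t\<^sup>2 * \<beta> / \<alpha>) / (1 + t\<^sup>2))) \<le> det_quot M X * k"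
    by (simp add: mult_ac)
  then have "k * ((1 + t\<^sup>2 * \<beta> / \<alpha>) / (1 + t\<^sup>2)) \<le> k"
    using pos by (simp only: mult_le_cancel_left_pos)
  then have "k * (1 + t\<^sup>2 * \<beta> / \<alpha>) \<le> k * (1 + t\<^sup>2)"
    using q by (simp add: pos_divide_le_eq)
  then have "t\<^sup>2 * (k * \<beta>) \<le> t\<^sup>2 * (k * \<alpha>)"
    using pos by (simp add: field_simps)
  then show ?thesis
    using t by simp
qed

lemma eigval_pos_of_det_quot_pos:
  fixes A :: "real^'n^'m" and X :: "real^'p^'n"
  assumes "X \<in> full_rank" "det_quot (transpose A ** A) X \<noteq> 0"
    and S: "orthonormal_eigenbasis (transpose A ** A) (span (columns X)) S" "s \<in> S"
  shows "0 < eigval (transpose A ** A) s"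
proof -
  have "(\<Prod>s\<in>S. eigval (transpose A ** A) s) \<noteq> 0"
    using assms det_quot_eigenbasis(2) by metis
  then have "eigval (transpose A ** A) s \<noteq> 0"
    using S orthonormal_eigenbasis_independent(2)[OF S(1)] by auto
  then show ?thesis
    using eigval_gram_nonneg[of A s] by linarith
qed

text \<open>With \<open>k = 1\<close> the point is a local maximum, with \<open>k = -1\<close> a local minimum.\<close>

lemma local_opt_eigenbases:
  fixes A :: "real^'n^'m" and X :: "real^'p^'n"
  defines "M \<equiv> transpose A ** A"
  assumes X: "X \<in> full_rank" and pos: "0 < det_quot M X" and "k \<noteq> 0"
    and opt: "\<forall>\<^sub>F Y in nhds X. k * det_quot M Y \<le> k * det_quot M X"
  obtains S T where "orthonormal_eigenbasis M (span (columns X)) S"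
    "orthonormal_eigenbasis M (orth_compl (span (columns X))) T"
    "\<forall>s\<in>S. \<forall>t\<in>T. k * eigval M t \<le> k * eigval M s"
proof -
  have M: "transpose M = M"
    by (simp add: M_def matrix_transpose_mul)
  obtain f' where f': "(det_quot M has_derivative f') (at X)"
    using twice_differentiable_on_det_quot[of M] X unfolding twice_differentiable_on_def by blast
  then have kf': "((\<lambda>Y. k * det_quot M Y) has_derivative (\<lambda>h. k * f' h)) (at X)"
    by (rule has_derivative_mult_right)
  obtain U where "open U" "X \<in> U" "\<forall>Y\<in>U. k * det_quot M Y \<le> k * det_quot M X"
    using opt unfolding eventually_nhds by blast
  \<comment> \<open>A local maximum of k f has derivative zero; as k is nonzero, X is stationary for
    f.\<close>
  then have "(\<lambda>h. k * f' h) = (\<lambda>_. 0)"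
    using differential_zero_maxmin[OF _ _ kf'] by blast
  then have "k * f' h = 0" for h
    by (rule fun_cong)
  then have "f' = (\<lambda>_. 0)"
    using \<open>k \<noteq> 0\<close> by auto
  with f' have "(det_quot M has_derivative (\<lambda>_. 0)) (at X)"
    by simp
  then obtain S T where S: "orthonormal_eigenbasis M (span (columns X)) S"
    and T: "orthonormal_eigenbasis M (orth_compl (span (columns X))) T"
    using stationary_eigenbases[OF M X] pos by (metis less_irrefl)
  moreover have "k * eigval M t \<le> k * eigval M s" if "s \<in> S" "t \<in> T" for s t
  proof (rule exchange_eigval_le[OF M pos])
    show "0 < eigval M s"
      using eigval_pos_of_det_quot_pos[OF X, of A S s] pos S that unfolding M_def by simp
    show "s \<in> span (columns X)" "t \<in> orth_compl (span (columns X))"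
      using that orthonormal_eigenbasis_independent(5)[OF S] orthonormal_eigenbasis_independent(5)[OF T]
      by auto
    show "norm s = 1" "M *v s = eigval M s *\<^sub>R s" "norm t = 1" "M *v t = eigval M t *\<^sub>R t"
      using that S T by (auto simp: orthonormal_eigenbasis_def)
  qed (rule opt)
  ultimately show ?thesis
    using that by blast
qed

section \<open>Sorted eigenbases and the list of singular values\<close>

lemma exists_sorted_enumeration:
  fixes e :: "'a \<Rightarrow> real"
  assumes "finite S"
  obtains xs where "distinct xs" "set xs = S" "sorted_wrt (\<ge>) (map e xs)"
proof -
  obtain ys where "distinct ys" "set ys = S"
    using finite_distinct_list[OF assms] by blast
  then show ?thesis
    using that[of "rev (sort_key e ys)"] by (simp add: sorted_wrt_rev flip: rev_map)
qed

text \<open>Maxima list the eigenbasis of the range first, minima that of the complement. Ties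
  between the two sets are harmless.\<close>

lemma exists_sorted_append:
  fixes e :: "'a \<Rightarrow> real"
  assumes "finite S" "finite T" "S \<inter> T = {}" "\<And>s t. s \<in> S \<Longrightarrow> t \<in> T \<Longrightarrow> e t \<le> e s"
  obtains xs ys where "set xs = S" "set ys = T" "distinct (xs @ ys)"
    "sorted_wrt (\<ge>) (map e (xs @ ys))"
proof -
  obtain xs where xs: "distinct xs" "set xs = S" "sorted_wrt (\<ge>) (map e xs)"
    using exists_sorted_enumeration[OF assms(1)] .
  obtain ys where ys: "distinct ys" "set ys = T" "sorted_wrt (\<ge>) (map e ys)"
    using exists_sorted_enumeration[OF assms(2)] .
  show ?thesis
    using that[of xs ys] xs ys assms(3,4) by (auto simp: sorted_wrt_append)
qed

text \<open>A sorted list is determined by its multiset, so every eigenbasis listed in nonincreasing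
  order yields the same values, however ties are ordered.\<close>

lemma rev_sorted_singular_values:
  fixes A :: "real^'n^'m"
  defines "M \<equiv> transpose A ** A"
  assumes B: "orthonormal_eigenbasis M UNIV (set xs)" and xs: "distinct xs"
    and sorted: "sorted_wrt (\<ge>) (map (eigval M) xs)"
  shows "rev (sorted_list_of_multiset (singular_values A)) = map (\<lambda>b. sqrt (eigval M b)) xs"
proof -
  let ?ys = "map (\<lambda>b. sqrt (eigval M b)) xs"
  have "singular_values A = mset ?ys"
    using singular_values_eq_eigenbasis[of A "set xs"] B xs
    by (simp add: mset_set_set M_def)
  moreover have "sorted (rev ?ys)"
    using sorted by (simp add: sorted_wrt_map sorted_wrt_rev flip: rev_map)
  then have "sort ?ys = rev ?ys"
    by (intro properties_for_sort) simp_all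
  ultimately show ?thesis
    by (simp only: sorted_list_of_multiset_mset rev_rev_ident)
qed

lemma sing_val_eq_nth:
  fixes A :: "real^'n^'m"
  defines "M \<equiv> transpose A ** A"
  assumes "orthonormal_eigenbasis M UNIV (set xs)" "distinct xs"
    and "sorted_wrt (\<ge>) (map (eigval M) xs)" and "i < length xs"
  shows "sing_val A (Suc i) = sqrt (eigval M (xs ! i))"
    "(sing_val A (Suc i))\<^sup>2 = eigval M (xs ! i)"
proof -
  show *: "sing_val A (Suc i) = sqrt (eigval M (xs ! i))"
    using assms(5) rev_sorted_singular_values[of A xs] assms(2-4)
    unfolding sing_val_def M_def by simp
  show "(sing_val A (Suc i))\<^sup>2 = eigval M (xs ! i)"
    unfolding * M_def by (simp add: eigval_gram_nonneg)
qed

lemma leading_factor_of_sorted_eigenbasis: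
  fixes A :: "real^'n^'m"
  defines "M \<equiv> transpose A ** A"
  assumes B: "orthonormal_eigenbasis M UNIV (set (xs @ ys))" and dist: "distinct (xs @ ys)"
    and sorted: "sorted_wrt (\<ge>) (map (eigval M) (xs @ ys))" and len: "length xs = CARD('p)"
  obtains V :: "real^'p^'n" where "leading_right_singular_factor A V"
    "span (columns V) = span (set xs)"
proof -
  have S: "orthonormal_eigenbasis M (span (set xs)) (set xs)"
    using B by (auto simp: orthonormal_eigenbasis_def pairwise_def)
  obtain g where g: "bij_betw g (UNIV :: 'p set) {0..<CARD('p)}"
    using finite_same_card_bij[of "UNIV :: 'p set" "{0..<CARD('p)}"] by auto
  then have g_less: "g j < length xs" for j
    unfolding len by (auto simp: bij_betw_def)
  have "bij_betw (\<lambda>i. xs ! i) {0..<CARD('p)} (set xs)"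
    using bij_betw_nth[of xs "{0..<CARD('p)}" "set xs"] dist len by (simp add: atLeast0LessThan)
  with g have c: "bij_betw (\<lambda>j. xs ! g j) UNIV (set xs)"
    using bij_betw_trans[of g UNIV] by (simp add: comp_def)
  define V :: "real^'p^'n" where "V = (\<chi> i j. (xs ! g j) $ i)"
  note V = eigenbasis_matrix[OF S c, folded V_def]
  \<comment> \<open>\<open>g\<close> numbers the columns from 0, while \<open>sing_val\<close>
    counts from 1.\<close>
  have "bij_betw (\<lambda>j. Suc (g j)) UNIV {1..CARD('p)}"
    using bij_betw_trans[OF g, of Suc "{1..CARD('p)}"]
    by (simp add: comp_def bij_betw_def image_Suc_atLeastLessThan atLeastLessThanSuc_atLeastAtMost)
  moreover have "column j V \<in> eigenspace M ((sing_val A (Suc (g j)))\<^sup>2)" for j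
  proof -
    have "(sing_val A (Suc (g j)))\<^sup>2 = eigval M ((xs @ ys) ! g j)"
      using sing_val_eq_nth(2)[of A "xs @ ys" "g j"] B dist sorted g_less[of j] unfolding M_def by simp
    then show ?thesis
      using S g_less[of j] nth_mem[of "g j" xs]
      by (simp add: V(1) eigenspace_def orthonormal_eigenbasis_def nth_append)
  qed
  ultimately have "leading_right_singular_factor A V"
    using V(2) unfolding leading_right_singular_factor_def M_def by blast
  then show ?thesis
    using that V(3) by blast
qed

text \<open>Listing S before T is a nonincreasing order even when values of S and T coincide, so S
  can occupy the first p positions.\<close>

lemma leading_factor_of_dominant_eigenspace:
  fixes A :: "real^'n^'m"
  defines "M \<equiv> transpose A ** A"
  assumes S: "orthonormal_eigenbasis M W S" and T: "orthonormal_eigenbasis M (orth_compl W) T"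
    and card: "card S = CARD('p)"
    and top: "\<And>s t. s \<in> S \<Longrightarrow> t \<in> T \<Longrightarrow> eigval M t \<le> eigval M s"
  obtains V :: "real^'p^'n" where "leading_right_singular_factor A V" "span (columns V) = W"
proof -
  have B: "orthonormal_eigenbasis M UNIV (S \<union> T)" and disj: "S \<inter> T = {}"
    using orthonormal_eigenbasis_Un[OF S T] .
  obtain xs ys where xs: "set xs = S" "set ys = T" "distinct (xs @ ys)"
      "sorted_wrt (\<ge>) (map (eigval M) (xs @ ys))"
    using exists_sorted_append[of S T "eigval M"] disj top
      orthonormal_eigenbasis_independent(2)[OF S] orthonormal_eigenbasis_independent(2)[OF T]
    by blast
  then have "length xs = CARD('p)"
    using card distinct_card[of xs] by simp
  then obtain V :: "real^'p^'n" where "leading_right_singular_factor A V"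
      "span (columns V) = span (set xs)"
    using leading_factor_of_sorted_eigenbasis[of A xs ys] B xs unfolding M_def by force
  then show ?thesis
    using that xs S by (simp add: orthonormal_eigenbasis_def)
qed

text \<open>The value does not depend on V, which makes it possible to recognise maximisers by their
  value alone.\<close>

lemma f_det_leading_factor:
  fixes V :: "real^'p^'n"
  assumes "leading_right_singular_factor A V"
  shows "V \<in> full_rank" "f_det A V = (\<Prod>i=1..CARD('p). (sing_val A i)\<^sup>2)"
proof -
  let ?M = "transpose A ** A"
  obtain \<pi> where VV: "transpose V ** V = mat 1" and \<pi>: "bij_betw \<pi> (UNIV :: 'p set) {1..CARD('p)}"
    and col: "\<And>j. ?M *v column j V = (sing_val A (\<pi> j))\<^sup>2 *\<^sub>R column j V"
    using assms by (auto simp: leading_right_singular_factor_def orthonormal_columns_def eigenspace_def)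
  show "V \<in> full_rank"
    by (simp add: full_rank_iff VV)
  have entry: "(transpose V ** N ** V) $ i $ j = column i V \<bullet> (N *v column j V)" for i j and N :: "real^'n^'n"
    unfolding matrix_mul_assoc[symmetric]
    by (simp add: column_def matrix_matrix_mult_def transpose_def matrix_vector_mult_def inner_vec_def)
  have "column i V \<bullet> column j V = (mat 1 :: real^'p^'p) $ i $ j" for i j
    using entry[where N = "mat 1"] by (simp add: VV)
  then have "(transpose V ** ?M ** V) $ i $ j = (if i = j then (sing_val A (\<pi> j))\<^sup>2 else 0)" for i j
    unfolding entry col by (simp add: mat_def)
  then have "det (transpose V ** ?M ** V) = (\<Prod>j\<in>UNIV. (sing_val A (\<pi> j))\<^sup>2)"
    by (subst det_diagonal) auto
  also have "\<dots> = (\<Prod>i=1..CARD('p). (sing_val A i)\<^sup>2)"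
    using \<pi> by (rule prod.reindex_bij_betw)
  finally show "f_det A V = (\<Prod>i=1..CARD('p). (sing_val A i)\<^sup>2)"
    by (simp add: f_det_eq_det_quot det_quot_def VV)
qed

lemma leading_factor_exists:
  fixes A :: "real^'n^'m"
  assumes "CARD('p) \<le> CARD('n)"
  obtains V :: "real^'p^'n" where "leading_right_singular_factor A V"
    "0 < sing_val A CARD('p) \<Longrightarrow> 0 < f_det A V"
proof -
  let ?M = "transpose A ** A"
  obtain B where B: "orthonormal_eigenbasis ?M UNIV B"
    using orthonormal_eigenbasis_exists[of ?M UNIV] by (auto simp: matrix_transpose_mul)
  obtain xs where xs: "distinct xs" "set xs = B" "sorted_wrt (\<ge>) (map (eigval ?M) xs)"
    using exists_sorted_enumeration[of B "eigval ?M"] orthonormal_eigenbasis_independent(2)[OF B] .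
  have "length xs = CARD('n)"
    using orthonormal_eigenbasis_independent(3)[OF B] xs distinct_card[of xs] by simp
  with assms have len: "CARD('p) \<le> length xs"
    by simp
  obtain V :: "real^'p^'n" where V: "leading_right_singular_factor A V"
    using leading_factor_of_sorted_eigenbasis[of A "take CARD('p) xs" "drop CARD('p) xs"]
      B xs len by auto
  moreover have "0 < f_det A V" if "0 < sing_val A CARD('p)"
  proof -
    have sv: "sing_val A (Suc i) = sqrt (eigval ?M (xs ! i))" if "i < length xs" for i
      using sing_val_eq_nth(1)[of A xs i] B xs that by simp
    \<comment> \<open>sigma_i is at least sigma_p for i up to p, so positivity of sigma_p reaches
      every factor of the product.\<close>
    have "0 < sing_val A i" if i: "i \<in> {1..CARD('p)}" for i
    proof -
      obtain j where j: "i = Suc j" "j \<le> CARD('p) - 1"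
        using i by (cases i) auto
      have l: "CARD('p) - 1 < length xs"
        using len by (metis One_nat_def Suc_pred less_eq_Suc_le zero_less_card_finite)
      have "eigval ?M (xs ! (CARD('p) - 1)) \<le> eigval ?M (xs ! j)"
        using sorted_wrt_nth_less[OF xs(3), of j "CARD('p) - 1"] j l
        by (cases "j = CARD('p) - 1") auto
      moreover have "Suc (CARD('p) - 1) = CARD('p)"
        by simp
      ultimately show ?thesis
        using sv[of j] sv[OF l] j l \<open>0 < sing_val A CARD('p)\<close> by simp
    qed
    then show ?thesis
      unfolding f_det_leading_factor(2)[OF V] by (intro prod_pos zero_less_power) blast
  qed
  ultimately show ?thesis
    using that by blast
qed

text \<open>The right-hand side depends only on A and the size of S, so two ranges that are both
  trailing can be compared.\<close>

lemma prod_eigval_bottom: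
  fixes A :: "real^'n^'m"
  defines "M \<equiv> transpose A ** A"
  assumes S: "orthonormal_eigenbasis M W S" and T: "orthonormal_eigenbasis M (orth_compl W) T"
    and bot: "\<And>s t. s \<in> S \<Longrightarrow> t \<in> T \<Longrightarrow> eigval M s \<le> eigval M t"
  shows "(\<Prod>s\<in>S. eigval M s)
    = prod_list (map power2 (drop (CARD('n) - card S)
        (rev (sorted_list_of_multiset (singular_values A)))))"
proof -
  have B: "orthonormal_eigenbasis M UNIV (S \<union> T)" and disj: "S \<inter> T = {}"
    using orthonormal_eigenbasis_Un[OF S T] .
  obtain ys xs where xs: "set ys = T" "set xs = S" "distinct (ys @ xs)"
      "sorted_wrt (\<ge>) (map (eigval M) (ys @ xs))"
    using exists_sorted_append[of T S "eigval M"] disj bot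
      orthonormal_eigenbasis_independent(2)[OF S] orthonormal_eigenbasis_independent(2)[OF T]
    by (metis inf_commute)
  have "length (ys @ xs) = card (S \<union> T)"
    using distinct_card[OF xs(3)] xs by (simp add: Un_commute)
  also have "\<dots> = CARD('n)"
    using orthonormal_eigenbasis_independent(3)[OF B] by simp
  finally have len: "length ys = CARD('n) - card S"
    using distinct_card[of xs] xs by simp
  have "rev (sorted_list_of_multiset (singular_values A)) = map (\<lambda>b. sqrt (eigval M b)) (ys @ xs)"
    using rev_sorted_singular_values[of A "ys @ xs"] B xs unfolding M_def by (simp add: Un_commute)
  then have "map power2 (drop (CARD('n) - card S)
      (rev (sorted_list_of_multiset (singular_values A)))) = map (eigval M) xs"
    by (simp add: M_def eigval_gram_nonneg flip: len)
  then show ?thesis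
    using xs prod.distinct_set_conv_list[of xs "eigval M"] by auto
qed

text \<open>Let P be the first p vectors of a sorted eigenbasis. If S = P, the gap would put the
  eigenvalue of s0 above that of t0. As S and P have the same size, each contains a vector outside
  the other: s from S lies below the gap, t from P above it.\<close>

lemma gap_exchange_pair:
  fixes A :: "real^'n^'m"
  defines "M \<equiv> transpose A ** A"
  assumes S: "orthonormal_eigenbasis M W S" and T: "orthonormal_eigenbasis M (orth_compl W) T"
    and not_top: "s0 \<in> S" "t0 \<in> T" "eigval M s0 < eigval M t0"
    and gap: "sing_val A (card S + 1) < sing_val A (card S)"
  obtains s t where "s \<in> S" "t \<in> T" "eigval M s \<le> (sing_val A (card S + 1))\<^sup>2"
    "(sing_val A (card S))\<^sup>2 \<le> eigval M t" "eigval M s < eigval M t"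
proof -
  let ?p = "card S"
  have B: "orthonormal_eigenbasis M UNIV (S \<union> T)" and disj: "S \<inter> T = {}"
    using orthonormal_eigenbasis_Un[OF S T] .
  have fin: "finite S" "finite T"
    using orthonormal_eigenbasis_independent(2)[OF S] orthonormal_eigenbasis_independent(2)[OF T] .
  obtain xs where xs: "distinct xs" "set xs = S \<union> T" "sorted_wrt (\<ge>) (map (eigval M) xs)"
    using exists_sorted_enumeration[of "S \<union> T" "eigval M"] fin by blast
  have "length xs = ?p + card T"
    using xs distinct_card[of xs] fin disj by (simp add: card_Un_disjoint)
  \<comment> \<open>Both bases are nonempty, so the 0-based positions p - 1 and p exist: sigma_p and
    sigma_(p+1) are entries of the list and not padding.\<close>
  moreover have p: "0 < ?p" "0 < card T"
    using fin not_top by (auto simp: card_gt_0_iff)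
  ultimately have len: "?p < length xs" "?p - 1 < length xs"
    by auto
  have sv: "(sing_val A (Suc i))\<^sup>2 = eigval M (xs ! i)" if "i < length xs" for i
    using sing_val_eq_nth(2)[of A xs i] B xs that unfolding M_def by simp
  have sp: "(sing_val A ?p)\<^sup>2 = eigval M (xs ! (?p - 1))"
    using sv[OF len(2)] p by simp
  have sp1: "(sing_val A (?p + 1))\<^sup>2 = eigval M (xs ! ?p)"
    using sv[OF len(1)] by simp
  have "0 \<le> sing_val A (?p + 1)"
    using sing_val_eq_nth(1)[of A xs ?p] B xs len eigval_gram_nonneg[of A "xs ! ?p"] unfolding M_def by simp
  with gap have lt: "(sing_val A (?p + 1))\<^sup>2 < (sing_val A ?p)\<^sup>2"
    by (intro power_strict_mono) auto
  have mono: "eigval M (xs ! j) \<le> eigval M (xs ! i)" if "i \<le> j" "j < length xs" for i j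
    using sorted_wrt_nth_less[OF xs(3), of i j] that by (cases "i = j") auto
  let ?P = "set (take ?p xs)"
  have P: "(sing_val A ?p)\<^sup>2 \<le> eigval M b" if "b \<in> ?P" for b
  proof -
    obtain i where "i < ?p" "b = xs ! i"
      using \<open>b \<in> ?P\<close> len(1) by (auto simp: in_set_conv_nth)
    then show ?thesis
      using mono[of i "?p - 1"] len by (simp add: sp)
  qed
  have N: "eigval M b \<le> (sing_val A (?p + 1))\<^sup>2" if "b \<in> S \<union> T" "b \<notin> ?P" for b
  proof -
    have "b \<in> set (drop ?p xs)"
      using that xs(2) by (metis Un_iff append_take_drop_id set_append)
    then obtain i where "?p + i < length xs" "b = xs ! (?p + i)"
      by (auto simp: in_set_conv_nth less_diff_conv add.commute)
    then show ?thesis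
      unfolding sp1 using mono[of ?p "?p + i"] by simp
  qed
  have "card ?P = ?p"
    using xs len by (simp add: distinct_card)
  moreover have "S \<noteq> ?P"
  proof
    assume "S = ?P"
    then have "eigval M t0 < eigval M s0"
      using P[of s0] N[of t0] lt not_top disj by force
    then show False
      using not_top by simp
  qed
  ultimately have "\<not> S \<subseteq> ?P" "\<not> ?P \<subseteq> S"
    using card_subset_eq[of ?P S] card_subset_eq[of S ?P] fin by auto
  then obtain s t where st: "s \<in> S" "s \<notin> ?P" "t \<in> ?P" "t \<notin> S"
    by blast
  then have "t \<in> T"
    using xs(2) set_take_subset[of ?p xs] by blast
  with st that[of s t] P[of t] N[of s] lt show ?thesis
    by auto
qed

section \<open>Local and global optima\<close>

text \<open>At x the inequality is trivial and S is open, so the punctured neighbourhood within S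
  can be filled; \<open>nhds\<close> then composes with limits along lines.\<close>

lemma local_max_on_nhds:
  assumes "open S"
  shows "local_max_on S f x \<longleftrightarrow> x \<in> S \<and> (\<forall>\<^sub>F y in nhds x. f y \<le> f x)"
proof -
  have "(\<forall>\<^sub>F y in at x. f y \<le> f x) \<longleftrightarrow> (\<forall>\<^sub>F y in nhds x. f y \<le> f x)"
    unfolding eventually_at_filter by (rule eventually_subst) (auto intro: always_eventually)
  then show ?thesis
    using at_within_open[OF _ assms] by (auto simp: local_max_on_def)
qed

lemma local_min_on_uminus: "local_min_on S f x \<longleftrightarrow> local_max_on S (\<lambda>y. - f y) x"
  by (simp add: local_min_on_def local_max_on_def)

lemma local_min_on_nhds:
  assumes "open S"
  shows "local_min_on S f x \<longleftrightarrow> x \<in> S \<and> (\<forall>\<^sub>F y in nhds x. f x \<le> f y)"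
  using local_max_on_nhds[OF assms, of "\<lambda>y. - f y"] by (simp add: local_min_on_uminus)

lemma global_max_on_iff: "global_max_on S f x \<longleftrightarrow> x \<in> S \<and> (\<forall>y\<in>S. f y \<le> f x)"
  by (auto simp: global_max_on_def is_arg_max_def not_less)

lemma global_min_on_iff: "global_min_on S f x \<longleftrightarrow> x \<in> S \<and> (\<forall>y\<in>S. f x \<le> f y)"
  by (auto simp: global_min_on_def is_arg_min_def not_less)

text \<open>An orthonormal eigenbasis of the identity on a subspace is just an orthonormal basis of
  it, so this orthonormalises the columns.\<close>

lemma orthonormal_representative:
  fixes X :: "real^'p^'n"
  assumes X: "X \<in> full_rank"
  obtains Q :: "real^'p^'n" where "orthonormal_columns Q" "det_quot M X = det_quot M Q"
proof -
  obtain S where S: "orthonormal_eigenbasis (mat 1) (span (columns X)) S"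
    using orthonormal_eigenbasis_exists[of "mat 1" "span (columns X)"] by auto
  then obtain c where c: "bij_betw c (UNIV :: 'p set) S"
    using finite_same_card_bij[of "UNIV :: 'p set" S] det_quot_eigenbasis(1)[OF X S]
    by (auto simp: orthonormal_eigenbasis_independent)
  show ?thesis
    using that[OF eigenbasis_matrix(2)[OF S c]] eigenbasis_matrix(3)[OF S c]
      det_quot_same_span(2)[OF X] by metis
qed

text \<open>The set is cut out by polynomial equations, and the squared norm of Q is the trace of
  Q^T Q, that is p.\<close>

lemma compact_orthonormal_columns:
  "compact {Q :: real^'p^'n. orthonormal_columns Q}"
proof -
  have eq: "(transpose Q ** Q) $ i $ j = (\<Sum>k\<in>UNIV. Q $ k $ i * Q $ k $ j)" for Q :: "real^'p^'n" and i j
    by (simp add: matrix_matrix_mult_def transpose_def)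
  have "closed {Q :: real^'p^'n. \<forall>i j. (\<Sum>k\<in>UNIV. Q $ k $ i * Q $ k $ j) = mat 1 $ i $ j}"
    by (intro closed_Collect_all closed_Collect_eq continuous_intros)
  then have "closed {Q :: real^'p^'n. orthonormal_columns Q}"
    by (simp add: orthonormal_columns_def vec_eq_iff eq)
  moreover have "norm Q \<le> sqrt (CARD('p))" if "orthonormal_columns Q" for Q :: "real^'p^'n"
  proof -
    have "(norm Q)\<^sup>2 = (\<Sum>k\<in>UNIV. \<Sum>i\<in>UNIV. Q $ k $ i * Q $ k $ i)"
      by (simp add: power2_norm_eq_inner inner_vec_def)
    also have "\<dots> = (\<Sum>i\<in>UNIV. (transpose Q ** Q) $ i $ i)"
      unfolding eq by (rule sum.swap)
    also have "\<dots> = CARD('p)"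
      using that by (simp add: orthonormal_columns_def mat_def)
    finally show ?thesis
      by (simp add: real_le_rsqrt)
  qed
  then have "bounded {Q :: real^'p^'n. orthonormal_columns Q}"
    unfolding bounded_iff by blast
  ultimately show ?thesis
    by (simp add: compact_eq_bounded_closed)
qed

lemma orthonormal_columns_full_rank: "orthonormal_columns Q \<Longrightarrow> Q \<in> full_rank"
  by (simp add: full_rank_iff orthonormal_columns_def)

text \<open>Replacing a point by an orthonormal basis of its range preserves the quotient, so optima are
  already attained on the compact set of matrices with orthonormal columns.\<close>

lemma global_opt_det_quot:
  fixes M :: "real^'n^'n"
  assumes "(full_rank :: (real^'p^'n) set) \<noteq> {}"
  obtains X :: "real^'p^'n" where "X \<in> full_rank" "\<forall>Y\<in>(full_rank :: (real^'p^'n) set). k * det_quot M Y \<le> k * det_quot M X"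
proof -
  let ?O = "{Q :: real^'p^'n. orthonormal_columns Q}"
  have "?O \<noteq> {}"
    using assms orthonormal_representative by (metis all_not_in_conv mem_Collect_eq)
  moreover have "continuous_on ?O (\<lambda>Q. k * det_quot M Q)"
    by (intro continuous_intros continuous_on_subset[OF twice_differentiable_on_imp_continuous_on
          [OF twice_differentiable_on_det_quot]]) (auto intro: orthonormal_columns_full_rank)
  ultimately obtain X where X: "X \<in> ?O" and max: "\<forall>Q\<in>?O. k * det_quot M Q \<le> k * det_quot M X"
    using continuous_attains_sup[OF compact_orthonormal_columns] by blast
  have "\<forall>Y\<in>(full_rank :: (real^'p^'n) set). k * det_quot M Y \<le> k * det_quot M X"
    using max orthonormal_representative[of _ M] by (metis mem_Collect_eq)
  with X show ?thesis
    using that orthonormal_columns_full_rank by blast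
qed

text \<open>A nonzero polynomial has finitely many roots, and a finite set does not accumulate at
  a.\<close>

lemma real_polynomial_function_zero:
  fixes q :: "real \<Rightarrow> real"
  assumes q: "real_polynomial_function q" and ev: "\<forall>\<^sub>F t in at a. q t = 0"
  shows "q t = 0"
proof -
  obtain c n where c: "q = (\<lambda>x. \<Sum>i\<le>n. c i * x ^ i)"
    using q real_polynomial_function_imp_sum by blast
  have "infinite {x. q x = 0}"
  proof
    assume "finite {x. q x = 0}"
    then have "\<not> a islimpt {x. q x = 0}"
      by (rule islimpt_finite)
    then have "\<forall>\<^sub>F t in at a. q t \<noteq> 0"
      by (simp add: islimpt_iff_eventually)
    with ev have "\<forall>\<^sub>F t in at a. False"
      by (rule eventually_elim2) simp
    then show False
      by simp
  qed
  then have "\<forall>i\<le>n. c i = 0"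
    using polyfun_finite_roots[of c n] by (auto simp: c)
  then show ?thesis
    by (simp add: c)
qed

lemma real_polynomial_function_det_line:
  fixes X D :: "real^'p^'n"
  shows "real_polynomial_function (\<lambda>t. det (transpose (X + t *\<^sub>R D) ** M ** (X + t *\<^sub>R D)))"
proof -
  have entry: "real_polynomial_function (\<lambda>t. (X + t *\<^sub>R D) $ i $ j)" for i j
    unfolding vector_add_component vector_scaleR_component real_scaleR_def
    by (intro real_polynomial_function.intros(2-4) real_polynomial_function.intros(1)[OF bounded_linear_ident])
  have "real_polynomial_function (\<lambda>t. (transpose (X + t *\<^sub>R D) ** M ** (X + t *\<^sub>R D)) $ i $ j)" for i j
    unfolding matrix_matrix_mult_def transpose_def vec_lambda_beta
    by (intro real_polynomial_function_sum real_polynomial_function.intros(2,4) entry finite)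
  then show ?thesis
    unfolding det_def
    by (intro real_polynomial_function_sum real_polynomial_function_prod
        real_polynomial_function.intros(2,4) finite_permutations finite)
qed

text \<open>The line from X to Y may leave the full-rank set, but the numerator is polynomial in t
  on the whole line; vanishing near t = 0, it vanishes at t = 1.\<close>

lemma f_det_eventually_zero:
  fixes X Y :: "real^'p^'n"
  assumes ev: "\<forall>\<^sub>F Z in nhds X. Z \<in> full_rank \<and> f_det A Z = 0"
  shows "f_det A Y = 0"
proof -
  let ?M = "transpose A ** A" and ?Z = "\<lambda>t. X + t *\<^sub>R (Y - X)"
  have "isCont ?Z 0"
    by (intro continuous_intros)
  then have "(?Z \<longlongrightarrow> X) (at 0)"
    by (simp add: isCont_def)
  with ev have "\<forall>\<^sub>F t in at 0. ?Z t \<in> full_rank \<and> f_det A (?Z t) = 0"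
    by (rule eventually_compose_filterlim)
  then have "\<forall>\<^sub>F t in at 0. det (transpose (?Z t) ** ?M ** ?Z t) = 0"
    by (rule eventually_mono) (auto simp: f_det_eq_det_quot det_quot_def full_rank_iff)
  from real_polynomial_function_zero[OF real_polynomial_function_det_line this, of 1]
  show ?thesis
    by (simp add: f_det_eq_det_quot det_quot_def)
qed

text \<open>Transposition preserves operator bounds, since the squared norm of X^T u is u . (X X^T
  u). The bound K is left free, to be the operator norm or 1.\<close>

lemma norm_transpose_mult_le:
  fixes X :: "real^'p^'n"
  assumes K: "\<And>x. norm (X *v x) \<le> K * norm x"
  shows "norm (transpose X *v u) \<le> K * norm u"
proof (cases "transpose X *v u = 0")
  case True
  \<comment> \<open>K is nonnegative because it bounds the image of a nonzero vector; any index
    serves, so \<open>undefined\<close> is taken.\<close>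
  have "0 \<le> K * norm (axis undefined 1 :: real^'p)"
    using K[of "axis undefined 1"] norm_ge_zero order_trans by blast
  then show ?thesis
    using True by (simp add: zero_le_mult_iff)
next
  case False
  let ?z = "transpose X *v u"
  have "norm ?z * norm ?z = u \<bullet> (X *v ?z)"
    by (simp only: inner_transpose_mult[symmetric] power2_norm_eq_inner[symmetric] power2_eq_square)
  also have "\<dots> \<le> norm u * norm (X *v ?z)"
    by (rule norm_cauchy_schwarz)
  also have "\<dots> \<le> norm u * (K * norm ?z)"
    by (intro mult_left_mono K) simp
  also have "\<dots> = (K * norm u) * norm ?z"
    by simp
  finally show ?thesis
    using False by (simp only: mult_le_cancel_right_pos zero_less_norm_iff not_False_eq_True)
qed

lemma orthonormal_columns_norm: "orthonormal_columns X \<Longrightarrow> norm (X *v x) = norm x"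
  for X :: "real^'p^'n"
proof -
  assume "orthonormal_columns X"
  then have "transpose X *v (X *v x) = x"
    by (simp only: matrix_vector_mul_assoc orthonormal_columns_def matrix_vector_mul_lid)
  then have "(X *v x) \<bullet> (X *v x) = x \<bullet> x"
    by (metis inner_transpose_mult)
  then show ?thesis
    by (simp add: norm_eq_sqrt_inner)
qed

section \<open>Maxima: leading ranges and the optimal value\<close>

lemma f_det_eq_of_same_span:
  fixes X Y :: "real^'p^'n"
  assumes "X \<in> full_rank" "span (columns X) = span (columns Y)"
  shows "f_det A X = f_det A Y"
  unfolding f_det_eq_det_quot using assms by (rule det_quot_same_span(2))

lemma local_max_leading_factor:
  fixes X :: "real^'p^'n"
  assumes X: "local_max_on full_rank (f_det A) X" and pos: "f_det A X \<noteq> 0"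
  obtains V :: "real^'p^'n" where "leading_right_singular_factor A V"
    "span (columns X) = span (columns V)"
proof -
  let ?M = "transpose A ** A"
  have R: "X \<in> full_rank" and ev: "\<forall>\<^sub>F Y in nhds X. 1 * det_quot ?M Y \<le> 1 * det_quot ?M X"
    using X by (simp_all add: local_max_on_nhds[OF open_full_rank] f_det_eq_det_quot)
  have pos: "0 < det_quot ?M X"
    using pos f_det_nonneg[of A X] by (simp add: f_det_eq_det_quot)
  obtain S T where S: "orthonormal_eigenbasis ?M (span (columns X)) S"
    and T: "orthonormal_eigenbasis ?M (orth_compl (span (columns X))) T"
    and top: "\<forall>s\<in>S. \<forall>t\<in>T. 1 * eigval ?M t \<le> 1 * eigval ?M s"
    using local_opt_eigenbases[OF R pos one_neq_zero ev] .
  obtain V :: "real^'p^'n" where "leading_right_singular_factor A V"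
      "span (columns V) = span (columns X)"
    by (rule leading_factor_of_dominant_eigenspace[OF S T det_quot_eigenbasis(1)[OF R S]])
      (use top in auto)
  then show ?thesis
    using that[of V] by simp
qed

lemma global_max_leading_value:
  fixes A :: "real^'n^'m"
  assumes "CARD('p) \<le> CARD('n)"
  shows "global_max_on full_rank (f_det A) (X :: real^'p^'n) \<longleftrightarrow>
    X \<in> full_rank \<and> f_det A X = (\<Prod>i=1..CARD('p). (sing_val A i)\<^sup>2)"
proof -
  let ?c = "\<Prod>i=1..CARD('p). (sing_val A i)\<^sup>2"
  obtain V :: "real^'p^'n" where V: "leading_right_singular_factor A V"
    using leading_factor_exists[OF assms] .
  obtain Z :: "real^'p^'n" where Z: "Z \<in> full_rank"
    and "\<forall>Y\<in>(full_rank :: (real^'p^'n) set). 1 * f_det A Y \<le> 1 * f_det A Z"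
    using global_opt_det_quot[of 1 "transpose A ** A"] f_det_leading_factor(1)[OF V]
    unfolding f_det_eq_det_quot by blast
  then have max: "f_det A Y \<le> f_det A Z" if "Y \<in> full_rank" for Y :: "real^'p^'n"
    using that by simp
  have "f_det A Z = ?c"
  \<comment> \<open>If the maximum is 0, then V, whose value is nonnegative, also attains 0, so the
    formula holds in this case too.\<close>
  proof (cases "f_det A Z = 0")
    case True
    then show ?thesis
      using max[OF f_det_leading_factor(1)[OF V]] f_det_nonneg[of A V] f_det_leading_factor(2)[OF V]
      by linarith
  next
    case False
    have "local_max_on full_rank (f_det A) Z"
      using Z max by (simp add: local_max_on_def eventually_at_filter)
    then show ?thesis
      using False Z by (metis local_max_leading_factor f_det_eq_of_same_span f_det_leading_factor(2))
  qed
  then show ?thesis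
    using Z max by (metis antisym global_max_on_iff)
qed

lemma local_max_imp_global_max:
  fixes A :: "real^'n^'m" and X :: "real^'p^'n"
  assumes p: "CARD('p) \<le> CARD('n)" and X: "local_max_on full_rank (f_det A) X"
  shows "global_max_on full_rank (f_det A) X"
proof (cases "f_det A X = 0")
  case True
  have R: "X \<in> full_rank" and ev: "\<forall>\<^sub>F Y in nhds X. f_det A Y \<le> f_det A X"
    using X by (simp_all add: local_max_on_nhds[OF open_full_rank])
  have "\<forall>\<^sub>F Y in nhds X. Y \<in> full_rank"
    using open_full_rank R by (rule eventually_nhds_in_open)
  \<comment> \<open>Since f is nonnegative, a local maximum with value 0 forces f to vanish on a
    whole neighbourhood.\<close>
  with ev have "\<forall>\<^sub>F Y in nhds X. Y \<in> full_rank \<and> f_det A Y = 0"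
    by (rule eventually_elim2) (use True f_det_nonneg in \<open>metis antisym\<close>)
  then have "f_det A Y = 0" for Y :: "real^'p^'n"
    by (rule f_det_eventually_zero)
  then show ?thesis
    using R by (simp add: global_max_on_iff)
next
  case False
  have R: "X \<in> full_rank"
    using X by (simp add: local_max_on_def)
  obtain V :: "real^'p^'n" where V: "leading_right_singular_factor A V"
      "span (columns X) = span (columns V)"
    using local_max_leading_factor[OF X False] .
  have "f_det A X = f_det A V"
    using f_det_eq_of_same_span[OF R V(2)] .
  then show ?thesis
    using R f_det_leading_factor(2)[OF V(1)] by (simp add: global_max_leading_value[OF p])
qed

text \<open>Without the eigenvalue 0, M and with it A has trivial kernel; then A X has full rank and
  the numerator is a nonzero Gram determinant.\<close>

lemma f_det_pos_of_positive_eigvals: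
  fixes A :: "real^'n^'m" and X :: "real^'p^'n"
  defines "M \<equiv> transpose A ** A"
  assumes B: "orthonormal_eigenbasis M UNIV B" and pos: "\<And>b. b \<in> B \<Longrightarrow> eigval M b \<noteq> 0"
    and X: "X \<in> full_rank"
  shows "f_det A X \<noteq> 0"
proof -
  have "transpose M = M"
    by (simp add: M_def matrix_transpose_mul)
  then have "dim (eigenspace M 0) = card {b \<in> B. eigval M b = 0}"
    by (rule dim_eigenspace[OF B])
  also have "{b \<in> B. eigval M b = 0} = {}"
    using pos by blast
  finally have "eigenspace M 0 \<subseteq> {0}"
    by (simp add: dim_eq_0)
  then have "M *v x = 0 \<Longrightarrow> x = 0" for x
    by (auto simp: eigenspace_def)
  then have "inj ((*v) A)"
    by (metis M_def matrix_left_invertible_injective matrix_left_invertible_ker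
        matrix_vector_mul_assoc matrix_vector_mult_0_right)
  moreover have "inj ((*v) X)"
    using X by (simp add: full_rank_def full_rank_injective)
  ultimately have "inj ((*v) (A ** X))"
    by (simp add: inj_def flip: matrix_vector_mul_assoc)
  then have "A ** X \<in> full_rank"
    by (simp add: full_rank_def full_rank_injective)
  then show ?thesis
    using X by (simp add: full_rank_iff f_det_def matrix_transpose_mul matrix_mul_assoc)
qed

lemma local_min_eigenbases:
  fixes A :: "real^'n^'m" and X :: "real^'p^'n"
  assumes X: "local_min_on full_rank (f_det A) X" and pos: "f_det A X \<noteq> 0"
  obtains S T where "orthonormal_eigenbasis (transpose A ** A) (span (columns X)) S"
    "orthonormal_eigenbasis (transpose A ** A) (orth_compl (span (columns X))) T"
    "\<forall>s\<in>S. \<forall>t\<in>T. eigval (transpose A ** A) s \<le> eigval (transpose A ** A) t"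
proof -
  let ?M = "transpose A ** A"
  have R: "X \<in> full_rank" and ev: "\<forall>\<^sub>F Y in nhds X. -1 * det_quot ?M Y \<le> -1 * det_quot ?M X"
    using X by (simp_all add: local_min_on_nhds[OF open_full_rank] f_det_eq_det_quot)
  have pos: "0 < det_quot ?M X"
    using pos f_det_nonneg[of A X] by (simp add: f_det_eq_det_quot)
  have "(-1 :: real) \<noteq> 0"
    by simp
  then obtain S T where S: "orthonormal_eigenbasis ?M (span (columns X)) S"
    and T: "orthonormal_eigenbasis ?M (orth_compl (span (columns X))) T"
    and bot: "\<forall>s\<in>S. \<forall>t\<in>T. -1 * eigval ?M t \<le> -1 * eigval ?M s"
    using local_opt_eigenbases[OF R pos _ ev] by blast
  show ?thesis
    by (rule that[OF S T]) (use bot in simp)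
qed

lemma local_min_value:
  fixes A :: "real^'n^'m" and X :: "real^'p^'n"
  assumes X: "local_min_on full_rank (f_det A) X" and pos: "f_det A X \<noteq> 0"
  shows "f_det A X = prod_list (map power2 (drop (CARD('n) - CARD('p))
    (rev (sorted_list_of_multiset (singular_values A)))))"
proof -
  let ?M = "transpose A ** A"
  have R: "X \<in> full_rank"
    using X by (simp add: local_min_on_def)
  obtain S T where S: "orthonormal_eigenbasis ?M (span (columns X)) S"
    and T: "orthonormal_eigenbasis ?M (orth_compl (span (columns X))) T"
    and bot: "\<forall>s\<in>S. \<forall>t\<in>T. eigval ?M s \<le> eigval ?M t"
    using local_min_eigenbases[OF X pos] .
  show ?thesis
    using prod_eigval_bottom[OF S T] bot det_quot_eigenbasis[OF R S]
    by (simp add: f_det_eq_det_quot)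
qed

text \<open>Value 0 is minimal since f is nonnegative. Otherwise X is compared with a global minimum
  Z through the common value of nonzero local minima, for which Z must be nonzero too: the
  eigenvalues on the range are positive and bound the others from below, so M is nonsingular and f
  has no zero of full rank.\<close>

lemma local_min_imp_global_min:
  fixes A :: "real^'n^'m" and X :: "real^'p^'n"
  assumes X: "local_min_on full_rank (f_det A) X"
  shows "global_min_on full_rank (f_det A) X"
proof (cases "f_det A X = 0")
  case True
  then show ?thesis
    using X f_det_nonneg by (metis global_min_on_iff local_min_on_def)
next
  case False
  let ?M = "transpose A ** A"
  have R: "X \<in> full_rank"
    using X by (simp add: local_min_on_def)
  obtain Z :: "real^'p^'n" where Z: "Z \<in> full_rank"
    and "\<forall>Y\<in>(full_rank :: (real^'p^'n) set). -1 * f_det A Y \<le> -1 * f_det A Z"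
    using global_opt_det_quot[of "-1" ?M] R unfolding f_det_eq_det_quot by blast
  then have min: "f_det A Z \<le> f_det A Y" if "Y \<in> full_rank" for Y :: "real^'p^'n"
    using that by simp
  obtain S T where S: "orthonormal_eigenbasis ?M (span (columns X)) S"
    and T: "orthonormal_eigenbasis ?M (orth_compl (span (columns X))) T"
    and bot: "\<forall>s\<in>S. \<forall>t\<in>T. eigval ?M s \<le> eigval ?M t"
    using local_min_eigenbases[OF X False] .
  have S_pos: "0 < eigval ?M s" if "s \<in> S" for s
    using eigval_pos_of_det_quot_pos[OF R _ S that] False by (simp add: f_det_eq_det_quot)
  have "card S \<noteq> 0"
    using det_quot_eigenbasis(1)[OF R S] by simp
  \<comment> \<open>S is nonempty, so its positive eigenvalues do bound those of T from
    below.\<close>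
  then obtain s where s: "s \<in> S"
    by fastforce
  have "eigval ?M b \<noteq> 0" if "b \<in> S \<union> T" for b
    using that S_pos bot s S_pos[OF s] by fastforce
  with Z have "f_det A Z \<noteq> 0"
    by (intro f_det_pos_of_positive_eigvals[OF orthonormal_eigenbasis_Un(1)[OF S T]])
  moreover have "local_min_on full_rank (f_det A) Z"
    using Z min by (simp add: local_min_on_def eventually_at_filter)
  ultimately have "f_det A Z = f_det A X"
    using local_min_value X False by metis
  then show ?thesis
    using R min by (simp add: global_min_on_iff)
qed

text \<open>Value 0 would make X a minimum, because f is nonnegative; a range dominating its
  complement would make X a maximum. What remains is a pair that an exchange improves.\<close>

lemma stationary_non_extremal_eigenbases:
  fixes A :: "real^'n^'m" and X :: "real^'p^'n"
  defines "M \<equiv> transpose A ** A"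
  assumes p: "CARD('p) \<le> CARD('n)" and stat: "stationary_on full_rank (f_det A) X"
    and not_max: "\<not> local_max_on full_rank (f_det A) X"
    and not_min: "\<not> local_min_on full_rank (f_det A) X"
  obtains S T s t where "0 < f_det A X" "card S = CARD('p)"
    "orthonormal_eigenbasis M (span (columns X)) S"
    "orthonormal_eigenbasis M (orth_compl (span (columns X))) T"
    "s \<in> S" "t \<in> T" "eigval M s < eigval M t"
proof -
  have R: "X \<in> full_rank" and deriv: "(det_quot M has_derivative (\<lambda>_. 0)) (at X)"
    using stat by (simp_all add: stationary_on_def gderiv_def f_det_eq_det_quot M_def)
  have "f_det A X \<noteq> 0"
  proof
    assume "f_det A X = 0"
    with R have "local_min_on full_rank (f_det A) X"
      by (simp add: local_min_on_def f_det_nonneg always_eventually)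
    with not_min show False ..
  qed
  then have pos: "0 < f_det A X"
    using f_det_nonneg[of A X] by simp
  have M: "transpose M = M"
    by (simp add: M_def matrix_transpose_mul)
  obtain S T where S: "orthonormal_eigenbasis M (span (columns X)) S"
    and T: "orthonormal_eigenbasis M (orth_compl (span (columns X))) T"
    using stationary_eigenbases[OF M R _ deriv] pos by (auto simp: f_det_eq_det_quot M_def)
  have card: "card S = CARD('p)"
    using det_quot_eigenbasis(1)[OF R S] .
  have "\<not> (\<forall>s\<in>S. \<forall>t\<in>T. eigval M t \<le> eigval M s)"
  proof
    assume "\<forall>s\<in>S. \<forall>t\<in>T. eigval M t \<le> eigval M s"
    then obtain V :: "real^'p^'n" where V: "leading_right_singular_factor A V"
        "span (columns V) = span (columns X)"
      using leading_factor_of_dominant_eigenspace[OF S[unfolded M_def] T[unfolded M_def] card]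
      unfolding M_def by metis
    then have "global_max_on full_rank (f_det A) X"
      using R f_det_eq_of_same_span[OF R V(2)[symmetric]] f_det_leading_factor(2)[OF V(1)]
        global_max_leading_value[OF p] by metis
    then have "local_max_on full_rank (f_det A) X"
      by (simp add: global_max_on_iff local_max_on_def eventually_at_filter)
    with not_max show False ..
  qed
  then show ?thesis
    using that[OF pos card S T] by (meson not_le)
qed

text \<open>As s and t are unit vectors, the direction has the norm of X^T s, which any operator
  bound K of X also bounds.\<close>

lemma exchange_direction_hessian:
  fixes A :: "real^'n^'m" and X :: "real^'p^'n"
  defines "M \<equiv> transpose A ** A"
  assumes R: "X \<in> full_rank" and pos: "0 < f_det A X"
    and S: "orthonormal_eigenbasis M (span (columns X)) S" "s \<in> S"
    and T: "orthonormal_eigenbasis M (orth_compl (span (columns X))) T" "t \<in> T"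
    and less: "eigval M s < eigval M t"
  obtains D where "ascent_direction (f_det A) X D"
    "hessian (f_det A) X D D = f_det A X * (eigval M t / eigval M s - 1)"
    "\<forall>K. (\<forall>x. norm (X *v x) \<le> K * norm x) \<longrightarrow> norm D \<le> K"
proof -
  let ?D = "outer t (transpose X *v s)"
  have M: "transpose M = M"
    by (simp add: M_def matrix_transpose_mul)
  have s_pos: "0 < eigval M s"
    using eigval_pos_of_det_quot_pos[OF R, of A S s] S pos unfolding M_def f_det_eq_det_quot by simp
  have s: "s \<in> span (columns X)" "norm s = 1" "M *v s = eigval M s *\<^sub>R s"
    and t: "t \<in> orth_compl (span (columns X))" "norm t = 1" "M *v t = eigval M t *\<^sub>R t"
    using orthonormal_eigenbasis_independent(5)[OF S(1)] orthonormal_eigenbasis_independent(5)[OF T(1)]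
      S T by (auto simp: orthonormal_eigenbasis_def)
  have hess: "hessian (f_det A) X ?D ?D = f_det A X * (eigval M t / eigval M s - 1)"
    unfolding f_det_eq_det_quot M_def[symmetric]
    using s_pos by (intro hessian_det_quot_exchange[OF R M] s t) simp
  moreover have "1 < eigval M t / eigval M s"
    using less s_pos by simp
  then have "0 < f_det A X * (eigval M t / eigval M s - 1)"
    using pos by simp
  then have "ascent_direction (f_det A) X ?D"
    by (simp only: ascent_direction_def hess)
  moreover have "norm ?D \<le> K" if "\<And>x. norm (X *v x) \<le> K * norm x" for K
    using norm_transpose_mult_le[OF that, of s] s(2) t(2) by (simp add: norm_outer)
  ultimately show ?thesis
    using that by blast
qed

text \<open>Here s and t are the exchanged eigenvalues, b and a are sigma_(p+1)^2 and sigma_p^2, n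
  is the norm of the direction and k an operator bound of X. The factors are compared separately: a
  / b is at most t / s, and n^2 / k^2 at most 1.\<close>

lemma spectral_gap_bound:
  fixes f b :: real
  assumes "0 < f" "0 < s" "s \<le> b" "a \<le> t" "s < t" "0 \<le> a" "0 \<le> n" "n \<le> k"
  shows "f * (a / b - 1) * n\<^sup>2 / k\<^sup>2 \<le> f * (t / s - 1)"
proof -
  have "a / b \<le> t / s"
    using assms by (intro frac_le) auto
  have r: "0 \<le> n\<^sup>2 / k\<^sup>2" "n\<^sup>2 / k\<^sup>2 \<le> 1"
    using assms power_mono[of n k 2] by (auto simp: divide_le_eq_1)
  have "0 < t / s - 1"
    using assms by simp
  then have "(a / b - 1) * (n\<^sup>2 / k\<^sup>2) \<le> (t / s - 1) * 1"
    using r \<open>a / b \<le> t / s\<close>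
    by (intro mult_mono) auto
  then have "f * ((a / b - 1) * (n\<^sup>2 / k\<^sup>2)) \<le> f * ((t / s - 1) * 1)"
    using assms by (intro mult_left_mono) auto
  then show ?thesis
    by (simp add: mult.assoc)
qed

text \<open>One direction serves both estimates: its norm is bounded by the operator norm of X, and
  by 1 when X is an isometry.\<close>

lemma strict_saddle_gap_direction:
  fixes A :: "real^'n^'m" and X :: "real^'p^'n"
  defines "f \<equiv> f_det A" and "p \<equiv> CARD('p)"
  assumes p: "p \<le> CARD('n)" and gap: "sing_val A (p + 1) < sing_val A p"
    and X: "strict_saddle_on full_rank f X"
  shows "\<exists>\<Delta>. ascent_direction f X \<Delta> \<and>
    hessian f X \<Delta> \<Delta> \<ge>
      f X * ((sing_val A p)\<^sup>2 / (sing_val A (p + 1))\<^sup>2 - 1) * (norm \<Delta>)\<^sup>2 / (onorm ((*v) X))\<^sup>2 \<and>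
    (orthonormal_columns X \<longrightarrow>
      hessian f X \<Delta> \<Delta> \<ge> f X * ((sing_val A p)\<^sup>2 / (sing_val A (p + 1))\<^sup>2 - 1) * (norm \<Delta>)\<^sup>2)"
proof -
  let ?M = "transpose A ** A"
  have stat: "stationary_on full_rank f X"
    and "\<not> local_max_on full_rank f X" "\<not> local_min_on full_rank f X"
    using X by (simp_all add: strict_saddle_on_def saddle_on_def)
  then obtain S T s0 t0 where pos: "0 < f X" and card: "card S = p"
    and S: "orthonormal_eigenbasis ?M (span (columns X)) S"
    and T: "orthonormal_eigenbasis ?M (orth_compl (span (columns X))) T"
    and st0: "s0 \<in> S" "t0 \<in> T" "eigval ?M s0 < eigval ?M t0"
    using stationary_non_extremal_eigenbases[of A X] p unfolding f_def p_def by metis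
  obtain s t where st: "s \<in> S" "t \<in> T" "eigval ?M s \<le> (sing_val A (p + 1))\<^sup>2"
      "(sing_val A p)\<^sup>2 \<le> eigval ?M t" "eigval ?M s < eigval ?M t"
    using gap_exchange_pair[OF S T st0] gap unfolding card by blast
  have R: "X \<in> full_rank"
    using stat by (simp add: stationary_on_def)
  have s_pos: "0 < eigval ?M s"
    using eigval_pos_of_det_quot_pos[OF R _ S st(1)] pos by (simp add: f_def f_det_eq_det_quot)
  obtain D where D: "ascent_direction f X D"
      "hessian f X D D = f X * (eigval ?M t / eigval ?M s - 1)"
      "\<forall>K. (\<forall>x. norm (X *v x) \<le> K * norm x) \<longrightarrow> norm D \<le> K"
    using exchange_direction_hessian[OF R pos[unfolded f_def] S st(1) T st(2,5)]
    unfolding f_def by metis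
  have "norm D \<le> onorm ((*v) X)"
    using D(3) onorm[OF matrix_vector_mul_bounded_linear[of X]] by blast
  moreover have "norm D \<le> 1" if "orthonormal_columns X"
    using that D(3) by (simp add: orthonormal_columns_norm)
  ultimately show ?thesis
    using D(1) spectral_gap_bound[OF pos s_pos st(3,4,5) zero_le_power2 norm_ge_zero, of D "onorm ((*v) X)"]
      spectral_gap_bound[OF pos s_pos st(3,4,5) zero_le_power2 norm_ge_zero, of D 1]
    by (intro exI[of _ D]) (simp add: D(2))
qed

theorem theorem1:
  fixes A :: "real^'n^'m"
    and R :: "(real^'p^'n) set"
    and f :: "real^'p^'n \<Rightarrow> real"
    and p :: nat
  defines "R \<equiv> full_rank"
    and "f \<equiv> f_det A"
    and "p \<equiv> CARD('p)"
  assumes "mean_centred A"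
    and "p \<le> CARD('n)"
  shows
    "(0 < sing_val A p \<longrightarrow>
       (\<forall>X. global_max_on R f X \<longleftrightarrow>
         (\<exists>V :: real^'p^'n. leading_right_singular_factor A V \<and>
            span (columns X) = span (columns V)))) \<and>
     (\<forall>X. (\<exists>V :: real^'p^'n. leading_right_singular_factor A V \<and>
            span (columns X) = span (columns V)) \<longrightarrow> global_max_on R f X) \<and>
     (\<forall>X. local_max_on R f X \<longrightarrow> global_max_on R f X) \<and>
     (\<forall>X. local_min_on R f X \<longrightarrow> global_min_on R f X) \<and>
     (\<forall>X. stationary_on R f X \<and> \<not> local_max_on R f X \<and> \<not> local_min_on R f X \<longrightarrow>
        strict_saddle_on R f X) \<and>
     (sing_val A p > sing_val A (p + 1) \<longrightarrow>
       (\<forall>X. strict_saddle_on R f X \<longrightarrow>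
         (\<exists>\<Delta>. ascent_direction f X \<Delta> \<and>
           hessian f X \<Delta> \<Delta> \<ge>
             f X * ((sing_val A p)\<^sup>2 / (sing_val A (p + 1))\<^sup>2 - 1) * (norm \<Delta>)\<^sup>2 / (onorm ((*v) X))\<^sup>2 \<and>
           (orthonormal_columns X \<longrightarrow>
             hessian f X \<Delta> \<Delta> \<ge>
               f X * ((sing_val A p)\<^sup>2 / (sing_val A (p + 1))\<^sup>2 - 1) * (norm \<Delta>)\<^sup>2))))"
proof -
  have p: "CARD('p) \<le> CARD('n)"
    using assms(5) by (simp add: p_def)
  have leading_max: "global_max_on R f X"
    if "leading_right_singular_factor A V" "span (columns X) = span (columns V)" for X V :: "real^'p^'n"
  proof -
    have "V \<in> full_rank"
      using that f_det_leading_factor by blast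
    then have "X \<in> full_rank" "f_det A V = f_det A X"
      using det_quot_same_span(1) f_det_eq_of_same_span that(2) by metis+
    then show ?thesis
      using f_det_leading_factor(2)[OF that(1)] by (simp add: R_def f_def global_max_leading_value[OF p])
  qed
  \<comment> \<open>Positivity of sigma_p makes the optimal value nonzero, as the description of
    local maxima by leading factors requires.\<close>
  have max_leading: "\<exists>V :: real^'p^'n. leading_right_singular_factor A V \<and>
      span (columns X) = span (columns V)"
    if "0 < sing_val A p" "global_max_on R f X" for X
  proof -
    obtain V :: "real^'p^'n" where V: "leading_right_singular_factor A V" "0 < f_det A V"
      using leading_factor_exists[OF p, of A] \<open>0 < sing_val A p\<close> unfolding p_def by metis
    have "f_det A X = f_det A V"
      using that(2) f_det_leading_factor(2)[OF V(1)]
      by (simp add: R_def f_def global_max_leading_value[OF p])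
    with V(2) have "f_det A X \<noteq> 0"
      by simp
    moreover have "local_max_on full_rank (f_det A) X"
      using that(2) by (simp add: R_def f_def global_max_on_iff local_max_on_def eventually_at_filter)
    ultimately show ?thesis
      using local_max_leading_factor by metis
  qed
  have saddle: "strict_saddle_on R f X"
    if sp: "stationary_on R f X" "\<not> local_max_on R f X" "\<not> local_min_on R f X" for X
  proof -
    obtain S T s t where "0 < f_det A X"
        "orthonormal_eigenbasis (transpose A ** A) (span (columns X)) S"
        "orthonormal_eigenbasis (transpose A ** A) (orth_compl (span (columns X))) T"
        "s \<in> S" "t \<in> T" "eigval (transpose A ** A) s < eigval (transpose A ** A) t"
      using stationary_non_extremal_eigenbases[OF p] sp unfolding R_def f_def by metis
    then have "\<exists>D. ascent_direction f X D"
      using exchange_direction_hessian[of X A S s T t] sp(1)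
      unfolding R_def f_def stationary_on_def by metis
    then show ?thesis
      using sp by (simp add: strict_saddle_on_def saddle_on_def)
  qed
  show ?thesis
  proof (intro conjI impI allI)
    fix X :: "real^'p^'n"
    assume "0 < sing_val A p"
    then show "global_max_on R f X \<longleftrightarrow> (\<exists>V :: real^'p^'n. leading_right_singular_factor A V \<and>
        span (columns X) = span (columns V))"
      using max_leading leading_max by blast
  next
    fix X :: "real^'p^'n"
    assume "\<exists>V :: real^'p^'n. leading_right_singular_factor A V \<and> span (columns X) = span (columns V)"
    then show "global_max_on R f X"
      using leading_max by blast
  next
    fix X :: "real^'p^'n"
    assume "local_max_on R f X"
    then show "global_max_on R f X"
      unfolding R_def f_def by (rule local_max_imp_global_max[OF p])
  next
    fix X :: "real^'p^'n"
    assume "local_min_on R f X"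
    then show "global_min_on R f X"
      unfolding R_def f_def by (rule local_min_imp_global_min)
  next
    fix X :: "real^'p^'n"
    assume "stationary_on R f X \<and> \<not> local_max_on R f X \<and> \<not> local_min_on R f X"
    then show "strict_saddle_on R f X"
      using saddle by blast
  next
    fix X :: "real^'p^'n"
    assume "sing_val A (p + 1) < sing_val A p" "strict_saddle_on R f X"
    then show "\<exists>\<Delta>. ascent_direction f X \<Delta> \<and>
      hessian f X \<Delta> \<Delta> \<ge>
        f X * ((sing_val A p)\<^sup>2 / (sing_val A (p + 1))\<^sup>2 - 1) * (norm \<Delta>)\<^sup>2 / (onorm ((*v) X))\<^sup>2 \<and>
      (orthonormal_columns X \<longrightarrow>
        hessian f X \<Delta> \<Delta> \<ge> f X * ((sing_val A p)\<^sup>2 / (sing_val A (p + 1))\<^sup>2 - 1) * (norm \<Delta>)\<^sup>2)"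
      using strict_saddle_gap_direction[of A X] p unfolding R_def f_def p_def by blast
  qed
qed

end
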